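(* Let $\zeta:\mathbb{C}\to\widehat{\mathbb{C}}$ be the Riemann zeta function, and let $\nu_\zeta:\mathbb{C}\to\widehat{\mathbb{C}}$ be the meromorphic function $\nu_\zeta(z):=z-\dfrac{\zeta(z)}{z\,\zeta'(z)}$. The following conditions are equivalent: (a) The Riemann hypothesis holds (every non-trivial zero of $\zeta$ lies on the line $\{s\in\mathbb{C}:\operatorname{Re}s=1/2\}$) and every non-trivial zero of $\zeta$ is simple. (b) Every non-trivial zero of $\zeta$ is an indifferent fixed point of $\nu_\zeta$. (c) The function $\nu_\zeta$ has no attracting fixed point. (d) There is no topological disk $D\subset\mathbb{C}$ with $\overline{\nu_\zeta(D)}\subset D$.
   Context: $\widehat{\mathbb{C}}=\mathbb{C}\cup\{\infty\}$ is the Riemann sphere; a meromorphic function on $\mathbb{C}$ is regarded as a holomorphic map $\mathbb{C}\to\widehat{\mathbb{C}}$, so quotients such as $\zeta(z)/(z\zeta'(z))$ are taken as meromorphic functions (removable singularities are filled in). The Riemann zeta function $\zeta$ is the meromorphic continuation to $\mathbb{C}$ of $\sum_{n\ge1}n^{-s}$ ($\operatorname{Re}s>1$). Its trivial zeros are $-2,-4,-6,\dots$; all other zeros are called non-trivial. For a meromorphic function $f$ on $\mathbb{C}$, a point $\alpha\in\mathbb{C}$ with $f(\alpha)=\alpha$ is a fixed point, with multiplier $f'(\alpha)$; it is attracting if $|f'(\alpha)|<1$, indifferent if $|f'(\alpha)|=1$, and repelling if $|f'(\alpha)|>1$. A topological disk is an open subset of $\mathbb{C}$ homeomorphic to the open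 unit disk; the closure $\overline{\nu_\zeta(D)}$ is taken in $\widehat{\mathbb{C}}$. *)

theory Defs
  imports "HOL-Complex_Analysis.Complex_Analysis"
begin

(* The Riemann sphere is the one-point compactification of the plane: None is the point at
   infinity and Some embeds the plane. *)
abbreviation riemann_sphere :: "complex option topology" where
  "riemann_sphere \<equiv> Alexandroff_compactification euclidean"

(* The map into the sphere given by a meromorphic function f. It depends only on the values of f
   on punctured neighbourhoods, so removable singularities are filled in and the values that HOL's
   total functions take at exceptional points (e.g. x / 0 = 0) do not matter. *)
definition sphere_map :: "(complex \<Rightarrow> complex) \<Rightarrow> complex \<Rightarrow> complex option" where
  "sphere_map f z = (if is_pole f z then None else Some (remove_sings f z))"

(* "Nicely meromorphic" fixes the value at every point (0 at a pole), so that the meromorphic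
   continuation is unique as a HOL function. *)
definition zeta :: "complex \<Rightarrow> complex" where
  "zeta = (THE f. f nicely_meromorphic_on UNIV \<and>
             (\<forall>s. Re s > 1 \<longrightarrow> (\<lambda>n. 1 / of_nat (Suc n) powr s) sums f s))"

lemma zeta_unique:
  assumes f: "f nicely_meromorphic_on UNIV"
    and fs: "\<And>s. Re s > 1 \<Longrightarrow> (\<lambda>n. 1 / of_nat (Suc n) powr s) sums f s"
  shows "zeta = f"
  unfolding zeta_def
proof (rule the_equality)
  fix g :: "complex \<Rightarrow> complex"
  assume g: "g nicely_meromorphic_on UNIV \<and>
    (\<forall>s. Re s > 1 \<longrightarrow> (\<lambda>n. 1 / of_nat (Suc n) powr s) sums g s)"
  show "g = f"
  proof
    fix z
    let ?h = "\<lambda>z. g z - f z"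
    have mero: "?h meromorphic_on UNIV"
      using f g by (intro meromorphic_intros) (auto simp: nicely_meromorphic_on_def)
    have "?h s = 0" if "Re s > 1" for s
      using g fs[OF that] that sums_unique2 by fastforce
    hence ev2: "eventually (\<lambda>s. ?h s = 0) (at 2)"
      by (intro eventually_at_in_open'[of "{s. Re s > 1}", THEN eventually_mono])
         (auto simp: open_halfspace_Re_gt)
    have "\<not> eventually (\<lambda>s. ?h s \<noteq> 0) (at 2)"
    proof
      assume "eventually (\<lambda>s. ?h s \<noteq> 0) (at 2)"
      with ev2 have "eventually (\<lambda>s. False) (at (2::complex))"
        by eventually_elim blast
      thus False by simp
    qed
    hence "\<not> eventually (\<lambda>s. ?h s \<noteq> 0) (cosparse UNIV)"
      by (auto simp: eventually_cosparse_open_eq)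
    hence "eventually (\<lambda>s. ?h s = 0) (cosparse UNIV)"
      using meromorphic_imp_constant_or_avoid[OF mero, of 0] by auto
    hence ev: "eventually (\<lambda>s. g s = f s) (at z)"
      by (auto simp: eventually_cosparse_open_eq)
    have "is_pole g z = is_pole f z"
      by (rule is_pole_cong[OF ev refl])
    moreover have "(g \<longlongrightarrow> l) (at z) = (f \<longlongrightarrow> l) (at z)" for l
      by (rule tendsto_cong[OF ev])
    moreover have "(is_pole g z \<and> g z = 0) \<or> g \<midarrow>z\<rightarrow> g z" "(is_pole f z \<and> f z = 0) \<or> f \<midarrow>z\<rightarrow> f z"
      using f g by (auto simp: nicely_meromorphic_on_def)
    moreover have "\<not> is_pole f z" if "f \<midarrow>z\<rightarrow> l" for l
      using that unfolding is_pole_def using not_tendsto_and_filterlim_at_infinity by force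
    ultimately show "g z = f z"
      by (metis LIM_unique)
  qed
qed (use assms in auto)

(* The multiplier is only used where f is finite, hence finite nearby: there f agrees locally with
   its complex-valued part. *)
definition multiplier :: "(complex \<Rightarrow> complex option) \<Rightarrow> complex \<Rightarrow> complex" where
  "multiplier f \<alpha> = deriv (\<lambda>z. the (f z)) \<alpha>"

definition fixed_point :: "(complex \<Rightarrow> complex option) \<Rightarrow> complex \<Rightarrow> bool" where
  "fixed_point f \<alpha> \<longleftrightarrow> f \<alpha> = Some \<alpha>"

definition attracting_fixed_point :: "(complex \<Rightarrow> complex option) \<Rightarrow> complex \<Rightarrow> bool" where
  "attracting_fixed_point f \<alpha> \<longleftrightarrow> fixed_point f \<alpha> \<and> norm (multiplier f \<alpha>) < 1"

definition indifferent_fixed_point :: "(complex \<Rightarrow> complex option) \<Rightarrow> complex \<Rightarrow> bool" where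
  "indifferent_fixed_point f \<alpha> \<longleftrightarrow> fixed_point f \<alpha> \<and> norm (multiplier f \<alpha>) = 1"

definition topological_disk :: "complex set \<Rightarrow> bool" where
  "topological_disk D \<longleftrightarrow> open D \<and> D homeomorphic ball (0::complex) 1"

(* Zeros are zeros of the sphere-valued map: as a HOL function zeta also takes the value 0 at its
   pole 1. *)
definition nontrivial_zeta_zero :: "complex \<Rightarrow> bool" where
  "nontrivial_zeta_zero s \<longleftrightarrow>
     sphere_map zeta s = Some 0 \<and> s \<notin> range (\<lambda>n. - 2 * of_nat (Suc n))"

definition riemann_hypothesis :: bool where
  "riemann_hypothesis \<longleftrightarrow> (\<forall>s. nontrivial_zeta_zero s \<longrightarrow> Re s = 1 / 2)"

definition nu_zeta :: "complex \<Rightarrow> complex option" where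
  "nu_zeta = sphere_map (\<lambda>z. z - zeta z / (z * deriv zeta z))"

end

(* At a zero a of zeta of order m the map nu_zeta has the fixed point a with multiplier
   1 - 1 / (m a), which lies inside, on or outside the unit circle according to whether m * Re a is
   greater than, equal to or less than 1/2. The only other fixed point is the pole 1, with multiplier
   2. If nothing is attracting then m * Re a <= 1/2 at every zero, and the symmetry a -> 1 - a of the
   non-trivial zeros turns this into Re a = 1/2 and m = 1; no zero-free region is needed.

   A disk containing the closure of its image has a fixed point by Brouwer, and a holomorphic map
   into a compact part of its domain contracts at its fixed points, by Cauchy's estimate for the
   iterates.

   The continuation to Re s > 0 compares the sum over n powr -s with the integral, so that zeta s on
   0 < s < 1 is lim (sum_(n<=N) n^-s - N^(1-s) / (1-s)). The functional equation then comes from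
   computing the integral over x > 0 of x^(s-1) (1 / (e^x - 1) - 1 / x) in two ways, through the
   geometric series and through the partial fractions of 1 / (e^x - 1), and the identity theorem. *)

theory Submission
  imports Defs "HOL-Real_Asymp.Real_Asymp"
begin

section \<open>Partial fractions of $1/(e^x-1)$\<close>

text \<open>On \<open>0 < s < 1\<close> the sums over \<open>n powr - s\<close> and over
  \<open>n powr (s - 1)\<close> both diverge, so summation over \<open>n\<close> and integration
  over \<open>x\<close> cannot simply be interchanged. Each partial sum is therefore paired with the
  integral of its own summand over \<open>t\<close> from 0 to \<open>N\<close>: for
  \<open>exp (- (t * x))\<close> this is \<open>(1 - exp (- (N * x))) / x\<close>, for
  \<open>2 * x / (x^2 + (2 * pi * t)^2)\<close> it is \<open>arctan (2 * pi * N / x) / pi\<close>.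
  The Mellin transforms of the differences are, up to constant factors, the compensated sums for
  zeta at \<open>s\<close> and at \<open>1 - s\<close>. In the limit the first subtrahend supplies
  the \<open>1 / x\<close>, and the second tends to 1/2, which cancels the 1/2 in the partial
  fractions of \<open>1 / (e^x - 1)\<close>. For real \<open>s\<close> both families are monotone in
  \<open>N\<close>, so monotone convergence suffices; hence real \<open>s\<close> comes before
  complex \<open>s\<close>. The factor \<open>s - 1\<close> is carried along throughout, so that the
  continuation is an entire function with value 1 at 1.\<close>

text \<open>Differentiate both sides of the reflection formula for
  \<open>rGamma z * rGamma (1 - z)\<close>. Keeping the sine as a factor avoids a division.\<close>

lemma Digamma_reflection:
  fixes z :: complex
  assumes z: "z \<notin> \<int>"
  shows "sin (of_real pi * z) * (Digamma (1 - z) - Digamma z) = of_real pi * cos (of_real pi * z)"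
proof -
  have z': "z \<notin> \<int>\<^sub>\<le>\<^sub>0" "1 - z \<notin> \<int>\<^sub>\<le>\<^sub>0"
    using z nonpos_Ints_Int Ints_diff[of 1 "1 - z"] by auto
  have "((\<lambda>z. rGamma z * rGamma (1 - z)) has_field_derivative
           (rGamma z * rGamma (1 - z) * (Digamma (1 - z) - Digamma z))) (at z)"
    using z' by (auto intro!: derivative_eq_intros simp: algebra_simps)
  moreover have "((\<lambda>z. rGamma z * rGamma (1 - z)) has_field_derivative
          (cos (of_real pi * z))) (at z)"
    unfolding rGamma_reflection_complex by (auto intro!: derivative_eq_intros)
  ultimately have "rGamma z * rGamma (1 - z) * (Digamma (1 - z) - Digamma z) = cos (of_real pi * z)"
    using DERIV_unique by blast
  then show ?thesis
    unfolding rGamma_reflection_complex by (simp add: field_simps)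
qed

text \<open>With \<open>z = i * y\<close>, the Digamma series at \<open>1 + z\<close> and
  \<open>1 - z\<close> differ termwise by \<open>2 * z / ((k + 1)^2 - z^2)\<close>, whose imaginary
  part is the summand. The recurrence and the reflection formula evaluate the difference.\<close>

lemma sums_coth_partial_fractions:
  fixes y :: real
  assumes y: "y > 0"
  shows "(\<lambda>k. 2 * y / ((real (Suc k))\<^sup>2 + y\<^sup>2)) sums (pi * cosh (pi * y) / sinh (pi * y) - 1 / y)"
proof -
  define z where "z = \<i> * complex_of_real y"
  have Rez [simp]: "Re z = 0" "Im z = y" by (auto simp: z_def)
  have zI: "z \<notin> \<int>" using y by (auto elim!: Ints_cases simp: complex_eq_iff)
  have nz: "1 + z \<noteq> 0" "1 - z \<noteq> 0" "z \<noteq> 0" using y by (auto simp: complex_eq_iff)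
  have D: "(\<lambda>k. inverse (of_nat (Suc k)) - inverse (w + of_nat k)) sums (Digamma w + euler_mascheroni)"
    if "w \<noteq> 0" for w :: complex
    using summable_sums[OF summable_Digamma[OF that]] by (simp add: Digamma_def)
  have "(\<lambda>k. (inverse (of_nat (Suc k)) - inverse (1 + z + of_nat k)) -
             (inverse (of_nat (Suc k)) - inverse (1 - z + of_nat k))) sums
        ((Digamma (1 + z) + euler_mascheroni) - (Digamma (1 - z) + euler_mascheroni))"
    by (intro sums_diff D nz)
  also have "(Digamma (1 + z) + euler_mascheroni) - (Digamma (1 - z) + euler_mascheroni) =
     1 / z - (Digamma (1 - z) - Digamma z)"
    using Digamma_plus1[of z] nz by (simp add: add.commute)
  also have "Digamma (1 - z) - Digamma z = -\<i> * of_real (pi * cosh (pi * y) / sinh (pi * y))"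
  proof -
    have pz: "of_real pi * z = \<i> * of_real (pi * y)" by (simp add: z_def)
    have "sin (of_real pi * z) = \<i> * of_real (sinh (pi * y))" "cos (of_real pi * z) = of_real (cosh (pi * y))"
      unfolding pz by (simp_all add: sin_i_times cos_i_times sinh_field_def cosh_field_def exp_minus flip: exp_of_real)
    moreover have "sinh (pi * y) \<noteq> 0" using y by simp
    ultimately have "\<i> * (of_real (sinh (pi * y)) * (Digamma (1 - z) - Digamma z)) = of_real (pi * cosh (pi * y))"
      using Digamma_reflection[OF zI] by (simp add: mult.assoc)
    from arg_cong[OF this, of "(*) (-\<i>)"]
    have "of_real (sinh (pi * y)) * (Digamma (1 - z) - Digamma z) = -\<i> * of_real (pi * cosh (pi * y))"
      by (simp add: mult.assoc[symmetric])
    moreover have "X = c / S" if "S * X = c" "S \<noteq> 0" for X c S :: complex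
      using that by auto
    ultimately have "Digamma (1 - z) - Digamma z = -\<i> * of_real (pi * cosh (pi * y)) / of_real (sinh (pi * y))"
      using \<open>sinh (pi * y) \<noteq> 0\<close> of_real_eq_0_iff by blast
    then show ?thesis by simp
  qed
  finally have "(\<lambda>k. Im ((inverse (of_nat (Suc k)) - inverse (1 + z + of_nat k)) -
             (inverse (of_nat (Suc k)) - inverse (1 - z + of_nat k)))) sums
       Im (1 / z - (-\<i> * of_real (pi * cosh (pi * y) / sinh (pi * y))))"
    by (rule sums_Im)
  moreover have "Im ((inverse (of_nat (Suc k)) - inverse (1 + z + of_nat k)) -
             (inverse (of_nat (Suc k)) - inverse (1 - z + of_nat k))) = 2 * y / ((real (Suc k))\<^sup>2 + y\<^sup>2)" for k
    by (simp flip: add_divide_distrib)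
  moreover have "Im (1 / z) = - 1 / y" using y by (simp add: Im_divide power2_eq_square)
  ultimately show ?thesis by simp
qed

text \<open>This is the expansion of the hyperbolic cotangent at \<open>x / 2\<close>, because
  \<open>1 / (exp x - 1) + 1 / 2\<close> is half of that cotangent.\<close>

lemma sums_bose_partial_fractions:
  fixes x :: real
  assumes x: "x > 0"
  shows "(\<lambda>k. 2 * x / (x\<^sup>2 + (2 * pi * real (Suc k))\<^sup>2)) sums (1 / (exp x - 1) - 1 / x + 1 / 2)"
proof -
  define y where "y = x / (2 * pi)"
  have y: "y > 0" and xy: "x = 2 * pi * y" using x by (auto simp: y_def)
  have 1: "exp x > 1" using x by simp
  have "(\<lambda>k. (1 / (2 * pi)) * (2 * y / ((real (Suc k))\<^sup>2 + y\<^sup>2))) sums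
      ((1 / (2 * pi)) * (pi * cosh (pi * y) / sinh (pi * y) - 1 / y))"
    by (intro sums_mult sums_coth_partial_fractions y)
  also have "(\<lambda>k. (1 / (2 * pi)) * (2 * y / ((real (Suc k))\<^sup>2 + y\<^sup>2))) =
       (\<lambda>k. 2 * x / (x\<^sup>2 + (2 * pi * real (Suc k))\<^sup>2))"
  proof
    fix k
    have "x\<^sup>2 + (2 * pi * real (Suc k))\<^sup>2 = 4 * pi\<^sup>2 * ((real (Suc k))\<^sup>2 + y\<^sup>2)"
      unfolding xy by (simp only: power2_eq_square) algebra
    moreover have "(real (Suc k))\<^sup>2 + y\<^sup>2 > 0" by (intro add_pos_nonneg) auto
    ultimately show "(1 / (2 * pi)) * (2 * y / ((real (Suc k))\<^sup>2 + y\<^sup>2)) = 2 * x / (x\<^sup>2 + (2 * pi * real (Suc k))\<^sup>2)"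
      by (simp add: xy power2_eq_square)
  qed
  also have "(1 / (2 * pi)) * (pi * cosh (pi * y) / sinh (pi * y) - 1 / y) = 1 / (exp x - 1) - 1 / x + 1 / 2"
  proof -
    define e where "e = exp (pi * y)"
    have e: "e > 1" using y by (simp add: e_def)
    have ex: "exp x = e * e" by (simp add: e_def xy flip: exp_add)
    have ee: "e * e > 1" using 1 ex by simp
    have "cosh (pi * y) / sinh (pi * y) = (e + 1 / e) / (e - 1 / e)"
    proof -
      have ch: "cosh (pi * y) = (e + 1 / e) / 2" and sh: "sinh (pi * y) = (e - 1 / e) / 2"
        by (simp_all add: cosh_field_def sinh_field_def exp_minus inverse_eq_divide e_def)
      have "(a / 2) / (b / 2) = a / b" for a b :: real by simp
      then show ?thesis unfolding ch sh .
    qed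
    also have "\<dots> = (e * e + 1) / (e * e - 1)"
      using e ee by (simp add: field_simps)
    finally have "pi * cosh (pi * y) / sinh (pi * y) = pi * ((e * e + 1) / (e * e - 1))"
      by (simp only: times_divide_eq_right[symmetric])
    then have "pi * cosh (pi * y) / sinh (pi * y) = pi * ((exp x + 1) / (exp x - 1))"
      by (simp only: ex)
    moreover have "1 / y = 2 * pi / x" using y by (simp add: xy)
    ultimately have "(1 / (2 * pi)) * (pi * cosh (pi * y) / sinh (pi * y) - 1 / y) =
        (exp x + 1) / (exp x - 1) / 2 - 1 / x"
      by (simp add: right_diff_distrib)
    also have "\<dots> = 1 / (exp x - 1) - 1 / x + 1 / 2"
      using 1 by (simp add: divide_simps) (simp add: algebra_simps)
    finally show ?thesis .
  qed
  finally show ?thesis .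
qed

section \<open>Mellin transforms\<close>

text \<open>Nonnegativity upgrades integrability to absolute integrability, which the change of
  variables theorem asks for.\<close>

lemma has_integral_substitution_nonneg:
  fixes f g g' :: "real \<Rightarrow> real"
  assumes S: "S \<in> sets lebesgue"
    and der: "\<And>x. x \<in> S \<Longrightarrow> (g has_field_derivative g' x) (at x within S)"
    and inj: "inj_on g S"
    and nonneg: "\<And>y. y \<in> g ` S \<Longrightarrow> f y \<ge> 0"
    and int: "(f has_integral b) (g ` S)"
  shows "((\<lambda>x. \<bar>g' x\<bar> * f (g x)) has_integral b) S"
proof -
  have "f absolutely_integrable_on g ` S"
    using int nonneg by (intro nonnegative_absolutely_integrable_1) auto
  then have "f absolutely_integrable_on g ` S \<and> integral (g ` S) f = b"
    using int by (auto dest: integral_unique)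
  then have "(\<lambda>x. \<bar>g' x\<bar> * f (g x)) absolutely_integrable_on S \<and>
      integral S (\<lambda>x. \<bar>g' x\<bar> * f (g x)) = b"
    using has_absolute_integral_change_of_variables_1'[OF S der inj, of f b] by blast
  then show ?thesis
    by (simp add: absolutely_integrable_on_def has_integral_iff)
qed

text \<open>On compact intervals exhausting the half-line, the integrals of \<open>u\<close> and
  \<open>v\<close> differ by boundary values of \<open>F\<close> that tend to 0. As \<open>u\<close>
  is nonnegative, monotone convergence turns this into integrability of \<open>u\<close>
  itself.\<close>

lemma has_integral_by_parts_Ioi:
  fixes F u v :: "real \<Rightarrow> real"
  assumes F: "\<And>x. x > 0 \<Longrightarrow> (F has_real_derivative u x - v x) (at x)"
    and u: "\<And>x. x > 0 \<Longrightarrow> u x \<ge> 0" and v: "\<And>x. x > 0 \<Longrightarrow> v x \<ge> 0"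
    and I: "(v has_integral I) {0<..}"
    and F0: "(F \<longlongrightarrow> 0) (at_right 0)" and Finf: "(F \<longlongrightarrow> 0) at_top"
  shows "(u has_integral I) {0<..}"
proof -
  define S where "S k = {1 / real (Suc k)..real (Suc k)}" for k
  have Spos: "S k \<subseteq> {0<..}" for k
    by (auto simp: S_def intro: less_le_trans[of _ "1 / (1 + real k)"])
  have S_mono: "S k \<subseteq> S (Suc k)" for k
    by (auto simp: S_def frac_le intro: order_trans[of _ "1 / (1 + real k)"])
  have S_ev: "\<forall>\<^sub>F k in sequentially. x \<in> S k" if "x > 0" for x
  proof -
    have "\<forall>\<^sub>F k in sequentially. 1 / real (Suc k) < x"
      using that by (intro order_tendstoD(2)[OF LIMSEQ_Suc[OF lim_1_over_n]]) auto
    moreover have "\<forall>\<^sub>F k in sequentially. real (Suc k) > x"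
      using filterlim_compose[OF filterlim_real_sequentially filterlim_Suc]
      by (auto simp: filterlim_at_top_dense)
    ultimately show ?thesis by eventually_elim (simp add: S_def)
  qed
  have vS: "v integrable_on S k" for k
    using integrable_on_subinterval[OF has_integral_integrable[OF I]] Spos[of k] unfolding S_def by blast
  have uv: "((\<lambda>x. u x - v x) has_integral (F (real (Suc k)) - F (1 / real (Suc k)))) (S k)" for k
    unfolding S_def
  proof (rule fundamental_theorem_of_calculus)
    show "1 / real (Suc k) \<le> real (Suc k)"
      by (simp add: field_simps)
    fix x assume "x \<in> {1 / real (Suc k)..real (Suc k)}"
    then have "x > 0" using Spos[of k] by (auto simp: S_def)
    then show "(F has_vector_derivative u x - v x) (at x within {1 / real (Suc k)..real (Suc k)})"
      using F has_field_derivative_at_within has_real_derivative_iff_has_vector_derivative by blast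
  qed
  have uS: "(u has_integral (F (real (Suc k)) - F (1 / real (Suc k)) + integral (S k) v)) (S k)" for k
    using has_integral_add[OF uv integrable_integral[OF vS]] by simp
  have mono: "f integrable_on S k \<Longrightarrow> (\<lambda>x. if x \<in> S k then f x else 0) integrable_on {0<..}"
    "f integrable_on S k \<Longrightarrow> integral {0<..} (\<lambda>x. if x \<in> S k then f x else 0) = integral (S k) f" for f :: "real \<Rightarrow> real" and k
    using Spos[of k] by (auto simp: integrable_restrict_Int integral_restrict_Int Int_absorb1 Int_absorb2)
  have lim: "(\<lambda>k. if x \<in> S k then f x else 0) \<longlonglongrightarrow> f x" if "x > 0" for x and f :: "real \<Rightarrow> real"
    by (rule tendsto_eventually, rule eventually_mono[OF S_ev[OF that]]) simp
  have le: "(if x \<in> S k then f x else 0) \<le> (if x \<in> S (Suc k) then f x else 0)"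
    if "x > 0" "\<And>x. x > 0 \<Longrightarrow> f x \<ge> 0" for x k and f :: "real \<Rightarrow> real"
    using that S_mono[of k] by auto
  have "v integrable_on {0<..} \<and>
      (\<lambda>k. integral {0<..} (\<lambda>x. if x \<in> S k then v x else 0)) \<longlonglongrightarrow> integral {0<..} v"
  proof (rule monotone_convergence_increasing)
    have "integral {0<..} (\<lambda>x. if x \<in> S k then v x else 0) \<in> {0..I}" for k
      using I v mono(1)[OF vS, of k]
      by (auto intro!: integral_nonneg has_integral_le[OF integrable_integral I] )
    then show "bounded (range (\<lambda>k. integral {0<..} (\<lambda>x. if x \<in> S k then v x else 0)))"
      by (intro bounded_subset[OF bounded_closed_interval[of 0 I]]) auto
  qed (use mono vS lim le v in auto)
  then have limv: "(\<lambda>k. integral (S k) v) \<longlonglongrightarrow> I"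
    using integral_unique[OF I] mono(2)[OF vS] by simp
  have "(\<lambda>k. F (real (Suc k))) \<longlonglongrightarrow> 0"
    by (rule LIMSEQ_Suc, rule filterlim_compose[OF Finf filterlim_real_sequentially])
  moreover have "(\<lambda>k. F (1 / real (Suc k))) \<longlonglongrightarrow> 0"
  proof (rule filterlim_compose[OF F0])
    show "filterlim (\<lambda>k. 1 / real (Suc k)) (at_right 0) sequentially"
      using LIMSEQ_Suc[OF lim_1_over_n[where 'a = real]]
      by (auto simp: filterlim_at)
  qed
  ultimately have limu: "(\<lambda>k. integral (S k) u) \<longlonglongrightarrow> I"
    using tendsto_add[OF tendsto_diff limv] uS[THEN integral_unique] by fastforce
  have ui: "u integrable_on S k" for k
    using uS by blast
  have "u integrable_on {0<..} \<and>
      (\<lambda>k. integral {0<..} (\<lambda>x. if x \<in> S k then u x else 0)) \<longlonglongrightarrow> integral {0<..} u"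
  proof (rule monotone_convergence_increasing)
    show "bounded (range (\<lambda>k. integral {0<..} (\<lambda>x. if x \<in> S k then u x else 0)))"
      using limu convergent_imp_bounded mono(2)[OF ui] by force
  qed (use mono ui lim le u in auto)
  then show ?thesis
    using limu mono(2)[OF ui] LIMSEQ_unique by (auto simp: has_integral_iff)
qed

section \<open>Mellin transforms of the two kernels and of their integrals over the summation
  variable\<close>

lemma has_integral_Gamma_scaled:
  fixes s n :: real
  assumes s: "s > 0" and n: "n > 0"
  shows "((\<lambda>x. x powr (s - 1) * exp (- (n * x))) has_integral (Gamma s * n powr - s)) {0<..}"
proof -
  have "((\<lambda>t. t powr (s - 1) / exp t) has_integral Gamma s) {0..}"
    by (rule Gamma_integral_real[OF s])
  then have G: "((\<lambda>t. t powr (s - 1) / exp t) has_integral Gamma s) {0<..}"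
    by (subst (asm) has_integral_spike_set_eq[where T = "{0<..}"]) (auto intro: negligible_subset[of "{0}"])
  have img: "(\<lambda>x. n * x) ` {0<..} = {0<..}"
    using n by (auto simp: image_iff intro!: bexI[of _ "_ / n"])
  have "((\<lambda>x. \<bar>n\<bar> * ((n * x) powr (s - 1) / exp (n * x))) has_integral Gamma s) {0<..}"
    by (rule has_integral_substitution_nonneg)
       (use n G in \<open>auto intro!: derivative_eq_intros simp: img inj_on_def\<close>)
  from has_integral_mult_right[OF this, of "n powr - s"]
  have "((\<lambda>x. n powr - s * (\<bar>n\<bar> * ((n * x) powr (s - 1) / exp (n * x)))) has_integral (Gamma s * n powr - s)) {0<..}"
    by (simp add: mult.commute)
  then show ?thesis
    by (rule has_integral_eq[rotated])
       (use n in \<open>auto simp: powr_mult powr_diff powr_minus exp_minus field_simps\<close>)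
qed

text \<open>The substitution \<open>u = x^2 / (x^2 + b^2)\<close> gives the Beta integral with
  parameters \<open>a\<close> and \<open>1 - a\<close> for \<open>a = (s + 1) / 2\<close>. By
  reflection it equals \<open>pi / sin (pi * a)\<close>, and the sine is a shifted cosine.\<close>

lemma has_integral_Mellin_inverse_square:
  fixes s b :: real
  assumes s: "-1 < s" "s < 1" and b: "b > 0"
  shows "((\<lambda>x. x powr (s - 1) * (2 * x / (x\<^sup>2 + b\<^sup>2))) has_integral
           (pi / cos (pi * s / 2) * b powr (s - 1))) {0<..}"
proof -
  define a where "a = (s + 1) / 2"
  have a: "0 < a" "a < 1" using s by (auto simp: a_def)
  have "Beta a (1 - a) = Gamma a * Gamma (1 - a)"
    by (simp add: Beta_def)
  also have "\<dots> = pi / sin (pi * a)"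
  proof -
    have "complex_of_real (Gamma a * Gamma (1 - a)) = Gamma (of_real a) * Gamma (1 - of_real a)"
      by (simp flip: Gamma_complex_of_real)
    also have "\<dots> = of_real pi / sin (of_real pi * of_real a)"
      by (rule Gamma_reflection_complex)
    also have "\<dots> = of_real (pi / sin (pi * a))"
      by (simp flip: sin_of_real)
    finally show ?thesis unfolding of_real_eq_iff .
  qed
  also have "pi * a = pi * s / 2 + pi / 2"
    by (simp add: a_def field_simps)
  also have "sin (pi * s / 2 + pi / 2) = cos (pi * s / 2)"
    by (simp add: sin_add)
  finally have Beta: "Beta a (1 - a) = pi / cos (pi * s / 2)" .
  define f where "f u = u powr (a - 1) * (1 - u) powr (- a)" for u :: real
  define g where "g x = x\<^sup>2 / (x\<^sup>2 + b\<^sup>2)" for x :: real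
  have pos: "x\<^sup>2 + b\<^sup>2 > 0" for x using b by (simp add: add_nonneg_pos)
  have "(f has_integral Beta a (1 - a)) {0..1}"
    using has_integral_Beta_real[of a "1 - a"] a by (simp add: f_def[abs_def])
  then have B: "(f has_integral (pi / cos (pi * s / 2))) {0<..<1}"
    unfolding Beta by (simp add: has_integral_Icc_iff_Ioo)
  have inj: "inj_on g {0<..}"
  proof (rule inj_onI)
    fix x y :: real assume xy: "x \<in> {0<..}" "y \<in> {0<..}" "g x = g y"
    then have "x\<^sup>2 * (y\<^sup>2 + b\<^sup>2) = y\<^sup>2 * (x\<^sup>2 + b\<^sup>2)"
      using pos[of x] pos[of y] by (simp add: g_def field_simps)
    then have "x\<^sup>2 = y\<^sup>2" using b by (simp add: algebra_simps)
    then show "x = y" using xy by simp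
  qed
  have img: "g ` {0<..} = {0<..<1}"
  proof safe
    fix x :: real assume "x > 0"
    then show "g x \<in> {0<..<1}" using b pos[of x] by (simp add: g_def)
  next
    fix t :: real assume t: "t \<in> {0<..<1}"
    define x where "x = b * sqrt (t / (1 - t))"
    have x2: "x\<^sup>2 = b\<^sup>2 * (t / (1 - t))" using t by (simp add: x_def power_mult_distrib)
    have "g x = t" unfolding g_def x2 using t b by (simp add: field_simps)
    moreover have "x > 0" using t b by (simp add: x_def)
    ultimately show "t \<in> g ` {0<..}" by force
  qed
  have "((\<lambda>x. \<bar>2 * x * b\<^sup>2 / (x\<^sup>2 + b\<^sup>2)\<^sup>2\<bar> * f (g x)) has_integral (pi / cos (pi * s / 2))) {0<..}"
  proof (rule has_integral_substitution_nonneg[where f = f and g = g])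
    fix x :: real assume "x \<in> {0<..}"
    show "(g has_field_derivative 2 * x * b\<^sup>2 / (x\<^sup>2 + b\<^sup>2)\<^sup>2) (at x within {0<..})"
      unfolding g_def using pos[of x]
      by (auto intro!: derivative_eq_intros simp: power2_eq_square field_simps)
  qed (use inj img B in \<open>auto simp: f_def\<close>)
  from has_integral_mult_right[OF this, of "b powr (s - 1)"]
  have "((\<lambda>x. b powr (s - 1) * (\<bar>2 * x * b\<^sup>2 / (x\<^sup>2 + b\<^sup>2)\<^sup>2\<bar> * f (g x))) has_integral
          (pi / cos (pi * s / 2) * b powr (s - 1))) {0<..}" by (simp add: mult.commute)
  then show ?thesis
  proof (rule has_integral_eq[rotated])
    fix x :: real assume "x \<in> {0<..}"
    then have x: "x > 0" by simp
    define w where "w = x\<^sup>2 + b\<^sup>2"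
    have w: "w > 0" using pos by (simp add: w_def)
    have sq: "z\<^sup>2 = z powr 2" if "z > 0" for z :: real using that by simp
    have 1: "1 - g x = b\<^sup>2 / w" using w unfolding g_def w_def[symmetric]
      by (simp add: divide_simps) (simp add: w_def)
    have "f (g x) = (x\<^sup>2 / w) powr (a - 1) * (b\<^sup>2 / w) powr (- a)"
      unfolding f_def 1 by (simp add: g_def w_def)
    also have "\<dots> = x powr (s - 1) * b powr (- s - 1) * w"
    proof -
      have p: "(y\<^sup>2) powr c = y powr (2 * c)" if "y > 0" for y c :: real
        unfolding sq[OF that] powr_powr ..
      have e: "2 * (a - 1) = s - 1" "2 * (- a) = - s - 1" by (simp_all add: a_def field_simps)
      have "(x\<^sup>2 / w) powr (a - 1) = x powr (s - 1) * w powr (1 - a)"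
        using w powr_minus_divide[of w "a - 1"] by (simp add: powr_divide p[OF x, of "a - 1", unfolded e])
      moreover have "(b\<^sup>2 / w) powr (- a) = b powr (- s - 1) * w powr a"
        using w powr_minus_divide[of w "- a"] by (simp add: powr_divide p[OF b, of "- a", unfolded e])
      moreover have "w powr (1 - a) * w powr a = w"
        using w by (simp flip: powr_add)
      ultimately show ?thesis by (simp add: mult_ac)
    qed
    finally have "f (g x) = x powr (s - 1) * b powr (- s - 1) * w" .
    note fg = this
    have "b powr (s - 1) * (\<bar>2 * x * b\<^sup>2 / (x\<^sup>2 + b\<^sup>2)\<^sup>2\<bar> * f (g x)) =
        (b powr (s - 1) * b powr (- s - 1) * b\<^sup>2) * (x powr (s - 1) * (2 * x / w))"
    proof -
      have "\<bar>2 * x * b\<^sup>2 / w\<^sup>2\<bar> = 2 * x * b\<^sup>2 / w\<^sup>2" using x by simp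
      with fg show ?thesis
        using w unfolding w_def[symmetric] by (simp add: power2_eq_square field_simps)
    qed
    also have "b powr (s - 1) * b powr (- s - 1) * b\<^sup>2 = 1"
    proof -
      have "b powr (s - 1) * b powr (- s - 1) = b powr - 2" by (simp flip: powr_add)
      then show ?thesis using b by (simp add: powr_neg_numeral)
    qed
    finally show "b powr (s - 1) * (\<bar>2 * x * b\<^sup>2 / (x\<^sup>2 + b\<^sup>2)\<^sup>2\<bar> * f (g x)) =
        x powr (s - 1) * (2 * x / (x\<^sup>2 + b\<^sup>2))" by (simp add: w_def)
  qed
qed

text \<open>Formally the integral of \<open>Gamma s * t powr - s\<close> over \<open>t\<close> from
  0 to \<open>n\<close>. Integration by parts leads back to the Gamma integral; the boundary term
  vanishes at 0 because \<open>s > 0\<close> and at infinity because \<open>s < 1\<close>.\<close>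

lemma has_integral_Mellin_one_minus_exp:
  fixes s n :: real
  assumes s: "0 < s" "s < 1" and n: "n > 0"
  shows "((\<lambda>x. x powr (s - 2) * (1 - exp (- (n * x)))) has_integral
           (Gamma s * (n powr (1 - s) / (1 - s)))) {0<..}"
proof (rule has_integral_by_parts_Ioi)
  define F where "F x = x powr (s - 1) * (1 - exp (- (n * x))) / (s - 1)" for x
  define v where "v x = n / (1 - s) * (x powr (s - 1) * exp (- (n * x)))" for x
  have "(v has_integral (n / (1 - s) * (Gamma s * n powr - s))) {0<..}"
    unfolding v_def by (intro has_integral_mult_right has_integral_Gamma_scaled s n)
  also have "n / (1 - s) * (Gamma s * n powr - s) = Gamma s * (n powr (1 - s) / (1 - s))"
    using n by (simp add: powr_diff powr_minus field_simps)
  finally show "(v has_integral (Gamma s * (n powr (1 - s) / (1 - s)))) {0<..}" .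
  show "(F has_real_derivative x powr (s - 2) * (1 - exp (- (n * x))) - v x) (at x)" if "x > 0" for x
  proof -
    have "((\<lambda>x. 1 - exp (- (n * x))) has_real_derivative n * exp (- (n * x))) (at x)"
      by (auto intro!: derivative_eq_intros)
    then have "(F has_real_derivative ((s - 1) * x powr (s - 1 - 1) * (1 - exp (- (n * x))) +
            n * exp (- (n * x)) * x powr (s - 1)) / (s - 1)) (at x)"
      unfolding F_def by (intro DERIV_cdivide DERIV_mult has_real_derivative_powr that)
    also have "((s - 1) * x powr (s - 1 - 1) * (1 - exp (- (n * x))) +
            n * exp (- (n * x)) * x powr (s - 1)) / (s - 1) =
          x powr (s - 2) * (1 - exp (- (n * x))) - v x"
    proof -
      have "n * exp (- (n * x)) * x powr (s - 1) / (s - 1) = - v x"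
        unfolding v_def using s by (simp add: divide_simps) (simp add: algebra_simps)
      moreover have "s - 1 - 1 = s - 2" by simp
      ultimately show ?thesis using s by (simp add: add_divide_distrib)
    qed
    finally show ?thesis .
  qed
  show "(F \<longlongrightarrow> 0) (at_right 0)"
    unfolding F_def using s n by real_asymp
  show "(F \<longlongrightarrow> 0) at_top"
    unfolding F_def using s n by real_asymp
qed (use s n in \<open>auto intro!: mult_nonneg_nonneg divide_nonneg_nonneg\<close>)

text \<open>\<open>arctan (b / x)\<close> is the integral of \<open>x / (x^2 + t^2)\<close> over
  \<open>t\<close> from 0 to \<open>b\<close>. By parts, its transform reduces to the rational one;
  the range of \<open>s\<close> again removes both boundary terms.\<close>

lemma has_integral_Mellin_arctan:
  fixes s b :: real
  assumes s: "0 < s" "s < 1" and b: "b > 0"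
  shows "((\<lambda>x. x powr (s - 1) * arctan (b / x)) has_integral
           (pi / cos (pi * s / 2) * (b powr s / (2 * s)))) {0<..}"
proof (rule has_integral_by_parts_Ioi)
  define F where "F x = x powr s * arctan (b / x) / s" for x
  define v where "v x = b / (2 * s) * (x powr (s - 1) * (2 * x / (x\<^sup>2 + b\<^sup>2)))" for x
  have pos: "x\<^sup>2 + b\<^sup>2 > 0" for x using b by (simp add: add_nonneg_pos)
  have "(v has_integral (b / (2 * s) * (pi / cos (pi * s / 2) * b powr (s - 1)))) {0<..}"
    unfolding v_def by (intro has_integral_mult_right has_integral_Mellin_inverse_square) (use s b in auto)
  also have "b / (2 * s) * (pi / cos (pi * s / 2) * b powr (s - 1)) =
      pi / cos (pi * s / 2) * (b powr s / (2 * s))"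
    using b by (simp add: powr_diff field_simps)
  finally show "(v has_integral (pi / cos (pi * s / 2) * (b powr s / (2 * s)))) {0<..}" .
  show "(F has_real_derivative x powr (s - 1) * arctan (b / x) - v x) (at x)" if x: "x > 0" for x
  proof -
    have D: "((\<lambda>x. arctan (b / x)) has_real_derivative - b / (x\<^sup>2 + b\<^sup>2)) (at x)"
      using x pos[of x]
      by (auto intro!: derivative_eq_intros simp: power2_eq_square divide_simps)
    have "(F has_real_derivative (s * x powr (s - 1) * arctan (b / x) + - b / (x\<^sup>2 + b\<^sup>2) * x powr s) / s) (at x)"
      unfolding F_def by (intro DERIV_cdivide DERIV_mult has_real_derivative_powr x D)
    also have "(s * x powr (s - 1) * arctan (b / x) + - b / (x\<^sup>2 + b\<^sup>2) * x powr s) / s =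
        x powr (s - 1) * arctan (b / x) - v x"
    proof -
      have "v x = b / (x\<^sup>2 + b\<^sup>2) * x powr s / s"
        using x by (simp add: v_def powr_diff)
      then show ?thesis using s by (simp add: add_divide_distrib diff_divide_distrib)
    qed
    finally show ?thesis .
  qed
  show "(F \<longlongrightarrow> 0) (at_right 0)"
    unfolding F_def using s b by real_asymp
  show "(F \<longlongrightarrow> 0) at_top"
    unfolding F_def using s b by real_asymp
  show "0 \<le> v x" if "x > 0" for x
    using that s b by (simp add: v_def)
qed (use s b in auto)

text \<open>\<open>z\<close> and \<open>z'\<close> stand for the values of zeta at \<open>s\<close>
  and \<open>1 - s\<close>. Both sides are the integral of \<open>h\<close>.\<close>

lemma zeta_functional_equation_limits:
  fixes s z z' :: real
  assumes s: "0 < s" "s < 1"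
    and z: "(\<lambda>N. (\<Sum>n<N. real (Suc n) powr - s) - real N powr (1 - s) / (1 - s)) \<longlonglongrightarrow> z"
    and z': "(\<lambda>N. (\<Sum>n<N. real (Suc n) powr (s - 1)) - real N powr s / s) \<longlonglongrightarrow> z'"
  shows "Gamma s * z = pi / cos (pi * s / 2) * (2 * pi) powr (s - 1) * z'"
proof -
  define C where "C = pi / cos (pi * s / 2)"
  define h where "h x = x powr (s - 1) * (1 / (exp x - 1) - 1 / x)" for x
  define f where "f N x = (\<Sum>n<N. x powr (s - 1) * exp (- (real (Suc n) * x))) -
      x powr (s - 2) * (1 - exp (- (real N * x)))" for N x
  define g where "g N x = (\<Sum>n<N. x powr (s - 1) * (2 * x / (x\<^sup>2 + (2 * pi * real (Suc n))\<^sup>2))) -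
      1 / pi * (x powr (s - 1) * arctan (2 * pi * real N / x))" for N x
  \<comment> \<open>\<open>f\<close> and \<open>g\<close> both decrease pointwise to \<open>h\<close>.\<close>
  have f_int: "(f (Suc N) has_integral (Gamma s * ((\<Sum>n<Suc N. real (Suc n) powr - s) -
      real (Suc N) powr (1 - s) / (1 - s)))) {0<..}" for N
  proof -
    have "(f (Suc N) has_integral ((\<Sum>n<Suc N. Gamma s * real (Suc n) powr - s) -
        Gamma s * (real (Suc N) powr (1 - s) / (1 - s)))) {0<..}"
      unfolding f_def
      by (intro has_integral_diff has_integral_sum has_integral_Gamma_scaled
          has_integral_Mellin_one_minus_exp s) auto
    then show ?thesis by (simp only: right_diff_distrib sum_distrib_left)
  qed
  have g_int: "(g (Suc N) has_integral (C * (2 * pi) powr (s - 1) * ((\<Sum>n<Suc N. real (Suc n) powr (s - 1)) -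
      real (Suc N) powr s / s))) {0<..}" for N
  proof -
    have "(g (Suc N) has_integral ((\<Sum>n<Suc N. C * (2 * pi * real (Suc n)) powr (s - 1)) -
      1 / pi * (C * ((2 * pi * real (Suc N)) powr s / (2 * s))))) {0<..}"
      unfolding g_def C_def
      by (intro has_integral_diff has_integral_sum has_integral_mult_right
            has_integral_Mellin_inverse_square has_integral_Mellin_arctan) (use s in auto)
    also have "(\<Sum>n<Suc N. C * (2 * pi * real (Suc n)) powr (s - 1)) =
        C * (2 * pi) powr (s - 1) * (\<Sum>n<Suc N. real (Suc n) powr (s - 1))"
      unfolding sum_distrib_left by (intro sum.cong) (auto simp: powr_mult)
    also have "1 / pi * (C * ((2 * pi * real (Suc N)) powr s / (2 * s))) =
        C * (2 * pi) powr (s - 1) * (real (Suc N) powr s / s)"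
    proof -
      have "(2 * pi * M) powr s = (2 * pi) * (2 * pi) powr (s - 1) * M powr s" if "M \<ge> 0" for M
        using that by (simp add: powr_mult powr_diff)
      from this[of "real (Suc N)"] show ?thesis
        by (simp del: of_nat_Suc)
    qed
    finally show ?thesis by (simp only: right_diff_distrib)
  qed
  have f_eq: "f N x = (1 - exp (- (real N * x))) * h x" if x: "x > 0" for N x
  proof -
    have e: "exp x > 1" using x by simp
    have "(\<Sum>n<N. exp (- (real (Suc n) * x))) = (1 - exp (- (real N * x))) / (exp x - 1)"
    proof (induction N)
      case (Suc N)
      have "exp (- (real (Suc N) * x)) * exp x = exp (- (real N * x))"
        by (simp add: algebra_simps flip: exp_add)
      with Suc show ?case using e by (simp add: field_simps)
    qed simp
    moreover have "x powr (s - 2) = x powr (s - 1) / x"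
      using x powr_diff[of x "s - 1" 1] by simp
    ultimately show ?thesis
      by (simp add: f_def h_def algebra_simps flip: sum_distrib_left)
  qed
  \<comment> \<open>This sign makes the sequence \<open>f\<close> decreasing, since its factor
    \<open>1 - exp (- (N * x))\<close> increases.\<close>
  have h_nonpos: "h x \<le> 0" if x: "x > 0" for x
  proof -
    have "x \<le> exp x - 1" using exp_ge_add_one_self[of x] by linarith
    then have "1 / (exp x - 1) \<le> 1 / x"
      using x by (intro divide_left_mono) auto
    then show ?thesis by (simp add: h_def mult_nonneg_nonpos)
  qed
  have "h integrable_on {0<..} \<and> (\<lambda>k. integral {0<..} (f (Suc k))) \<longlonglongrightarrow> integral {0<..} h"
  proof (rule monotone_convergence_decreasing)
    show "f (Suc (Suc k)) x \<le> f (Suc k) x" if "x \<in> {0<..}" for k x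
      using that h_nonpos[of x] by (auto simp: f_eq intro!: mult_right_mono_neg)
    show "(\<lambda>k. f (Suc k) x) \<longlonglongrightarrow> h x" if "x \<in> {0<..}" for x
    proof -
      have "(\<lambda>k. (1 - exp (- (real (Suc k) * x))) * h x) \<longlonglongrightarrow> (1 - 0) * h x"
      proof (intro tendsto_intros)
        show "(\<lambda>k. exp (- (real (Suc k) * x))) \<longlonglongrightarrow> 0"
          using that by (simp, real_asymp)
      qed
      then show ?thesis using that by (simp add: f_eq)
    qed
    have "(\<lambda>k. integral {0<..} (f (Suc k))) \<longlonglongrightarrow> Gamma s * z"
      unfolding integral_unique[OF f_int] by (intro tendsto_intros LIMSEQ_Suc[OF z])
    then show "bounded (range (\<lambda>k. integral {0<..} (f (Suc k))))"
      by (rule convergent_imp_bounded)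
  qed (use f_int in blast)
  then have "(\<lambda>k. Gamma s * ((\<Sum>n<Suc k. real (Suc n) powr - s) - real (Suc k) powr (1 - s) / (1 - s)))
      \<longlonglongrightarrow> integral {0<..} h"
    unfolding integral_unique[OF f_int] by blast
  moreover have "(\<lambda>k. Gamma s * ((\<Sum>n<Suc k. real (Suc n) powr - s) - real (Suc k) powr (1 - s) / (1 - s)))
      \<longlonglongrightarrow> Gamma s * z"
    by (intro tendsto_intros LIMSEQ_Suc[OF z])
  ultimately have h_eq: "Gamma s * z = integral {0<..} h"
    using LIMSEQ_unique by blast
  have glim: "(\<lambda>k. integral {0<..} (g (Suc k))) \<longlonglongrightarrow> C * (2 * pi) powr (s - 1) * z'"
    unfolding integral_unique[OF g_int] by (intro tendsto_intros LIMSEQ_Suc[OF z'])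
  have "h integrable_on {0<..} \<and> (\<lambda>k. integral {0<..} (g (Suc k))) \<longlonglongrightarrow> integral {0<..} h"
  proof (rule monotone_convergence_decreasing)
    show "g (Suc (Suc k)) x \<le> g (Suc k) x" if "x \<in> {0<..}" for k x
    proof -
      have x: "x > 0" using that by simp
      define N where "N = Suc k"
      \<comment> \<open>The subtracted term grows from \<open>N\<close> to \<open>N + 1\<close> by
        the summand at an intermediate \<open>y\<close>. This is at least the summand added at
        \<open>N + 1\<close>, as the summand decreases in its index; so \<open>g\<close>
        decreases.\<close>
      have "\<exists>y>real N. y < real (Suc N) \<and>
          arctan (2 * pi * real (Suc N) / x) - arctan (2 * pi * real N / x) =
          (real (Suc N) - real N) * (2 * pi * x / (x\<^sup>2 + (2 * pi * y)\<^sup>2))"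
      proof (rule MVT2)
        fix y :: real
        have "x\<^sup>2 + (2 * pi * y)\<^sup>2 > 0" using x by (simp add: add_pos_nonneg)
        then show "((\<lambda>y. arctan (2 * pi * y / x)) has_real_derivative 2 * pi * x / (x\<^sup>2 + (2 * pi * y)\<^sup>2)) (at y)"
          using x by (auto intro!: derivative_eq_intros simp: power2_eq_square divide_simps)
      qed simp
      then obtain y where y: "real N < y" "y < real (Suc N)"
        and eq: "arctan (2 * pi * real (Suc N) / x) - arctan (2 * pi * real N / x) = 2 * pi * x / (x\<^sup>2 + (2 * pi * y)\<^sup>2)"
        by auto
      have "2 * x / (x\<^sup>2 + (2 * pi * real (Suc N))\<^sup>2) \<le> 2 * x / (x\<^sup>2 + (2 * pi * y)\<^sup>2)"
        using x y by (intro divide_left_mono add_left_mono power_mono mult_pos_pos add_pos_nonneg) auto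
      also have "\<dots> = 1 / pi * (arctan (2 * pi * real (Suc N) / x) - arctan (2 * pi * real N / x))"
        unfolding eq by simp
      finally have "x powr (s - 1) * (2 * x / (x\<^sup>2 + (2 * pi * real (Suc N))\<^sup>2)) \<le>
          x powr (s - 1) * (1 / pi * (arctan (2 * pi * real (Suc N) / x) - arctan (2 * pi * real N / x)))"
        by (intro mult_left_mono) auto
      then show ?thesis
        unfolding N_def[symmetric] by (simp add: g_def algebra_simps)
    qed
    show "(\<lambda>k. g (Suc k) x) \<longlonglongrightarrow> h x" if "x \<in> {0<..}" for x
    proof -
      have x: "x > 0" using that by simp
      have "(\<lambda>k. (\<Sum>n<k. 2 * x / (x\<^sup>2 + (2 * pi * real (Suc n))\<^sup>2))) \<longlonglongrightarrow> 1 / (exp x - 1) - 1 / x + 1 / 2"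
        using sums_bose_partial_fractions[OF x] by (simp add: sums_def)
      moreover have "(\<lambda>k. arctan (2 * pi * real k / x)) \<longlonglongrightarrow> pi / 2"
        using x by real_asymp
      \<comment> \<open>The limit \<open>pi / 2\<close> of the arctangent, divided by
        \<open>pi\<close>, removes the constant 1/2 of the partial fractions.\<close>
      ultimately have "(\<lambda>k. x powr (s - 1) * ((\<Sum>n<k. 2 * x / (x\<^sup>2 + (2 * pi * real (Suc n))\<^sup>2)) -
           1 / pi * arctan (2 * pi * real k / x))) \<longlonglongrightarrow>
          x powr (s - 1) * ((1 / (exp x - 1) - 1 / x + 1 / 2) - 1 / pi * (pi / 2))"
        by (intro tendsto_intros)
      then have "(\<lambda>k. g k x) \<longlonglongrightarrow> h x"
        by (simp add: g_def h_def right_diff_distrib sum_distrib_left mult_ac)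
      then show ?thesis by (rule LIMSEQ_Suc)
    qed
    show "bounded (range (\<lambda>k. integral {0<..} (g (Suc k))))"
      using glim by (rule convergent_imp_bounded)
  qed (use g_int in blast)
  then have "integral {0<..} h = C * (2 * pi) powr (s - 1) * z'"
    using glim LIMSEQ_unique by blast
  with h_eq show ?thesis by (simp add: C_def)
qed

section \<open>Continuation and functional equation of the zeta function\<close>

text \<open>\<open>zeta_corr n s\<close> is \<open>s - 1\<close> times the difference of the \<open>n\<close>-th term of the Dirichlet series
  and the integral of \<open>x powr -s\<close> over the unit interval to its right; the factor removes the pole
  at 1. It is also a first-order Taylor remainder of \<open>x powr (1 - s)\<close>.\<close>

definition zeta_corr :: "nat \<Rightarrow> complex \<Rightarrow> complex" where
  "zeta_corr n s = (s - 1) * of_nat (Suc n) powr - s +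
     of_nat (Suc (Suc n)) powr (1 - s) - of_nat (Suc n) powr (1 - s)"

text \<open>This is \<open>(s - 1) * zeta s\<close> for \<open>Re s > 0\<close>. The leading 1 is
  \<open>s - 1\<close> times the integral of \<open>x powr - s\<close> over
  \<open>x > 1\<close>.\<close>

definition zeta_right :: "complex \<Rightarrow> complex" where
  "zeta_right s = 1 + (\<Sum>n. zeta_corr n s)"

text \<open>Taylor's theorem for \<open>x powr (1 - s)\<close> between \<open>n + 1\<close> and
  \<open>n + 2\<close>: the second derivative is bounded by its modulus at the left end, because
  \<open>Re s > 0\<close>. The gain of one power gives convergence to the left of
  \<open>Re s = 1\<close>.\<close>

lemma norm_zeta_corr_le:
  assumes s: "Re s > 0"
  shows "norm (zeta_corr n s) \<le> norm (1 - s) * norm s * real (Suc n) powr (- Re s - 1)"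
proof -
  define f where "f i x = (if i = 0 then x powr (1 - s) else if i = 1 then (1 - s) * x powr - s
    else (1 - s) * (- s * x powr (- s - 1)))" for i :: nat and x :: complex
  define S where "S = closed_segment (complex_of_real (real (Suc n))) (of_real (real (Suc (Suc n))))"
  have S: "\<exists>t. x = of_real t \<and> t \<ge> real (Suc n)" if "x \<in> S" for x
    using that unfolding S_def closed_segment_of_real by (auto simp: closed_segment_eq_real_ivl)
  have "norm (f 0 (of_real (real (Suc (Suc n)))) - (\<Sum>i\<le>1. f i (of_real (real (Suc n))) *
         (of_real (real (Suc (Suc n))) - of_real (real (Suc n))) ^ i / fact i)) \<le>
     (norm (1 - s) * norm s * real (Suc n) powr (- Re s - 1)) *
       norm (complex_of_real (real (Suc (Suc n))) - of_real (real (Suc n))) ^ (Suc 1) / fact 1"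
  proof (rule complex_Taylor[of S])
    show "(f i has_field_derivative f (Suc i) x) (at x within S)" if x: "x \<in> S" and i: "i \<le> 1" for i x
    proof -
      obtain t where t: "x = of_real t" "t \<ge> real (Suc n)" using S[OF x] by blast
      have nr: "x \<notin> \<real>\<^sub>\<le>\<^sub>0" using t by (auto simp: complex_nonpos_Reals_iff)
      have "((\<lambda>x. x powr (1 - s)) has_field_derivative (1 - s) * x powr (1 - s - 1)) (at x within S)"
        "((\<lambda>x. (1 - s) * x powr - s) has_field_derivative (1 - s) * (- s * x powr (- s - 1))) (at x within S)"
        by (intro DERIV_cmult has_field_derivative_at_within[OF has_field_derivative_powr] nr)+
      moreover from i have "i = 0 \<or> i = 1" by auto
      ultimately show ?thesis by (auto simp: f_def[abs_def])
    qed
    show "norm (f (Suc 1) x) \<le> norm (1 - s) * norm s * real (Suc n) powr (- Re s - 1)" if x: "x \<in> S" for x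
    proof -
      obtain t where t: "x = of_real t" "t \<ge> real (Suc n)" using S[OF x] by blast
      have "norm (x powr (- s - 1)) = t powr (- Re s - 1)"
        using t by (simp add: norm_powr_real_powr)
      also have "\<dots> \<le> real (Suc n) powr (- Re s - 1)"
        using t s by (intro powr_mono2') auto
      finally have "norm (1 - s) * norm s * norm (x powr (- s - 1)) \<le>
          norm (1 - s) * norm s * real (Suc n) powr (- Re s - 1)"
        by (intro mult_left_mono) auto
      then show ?thesis by (simp add: f_def norm_mult mult.assoc)
    qed
  qed (auto simp: S_def)
  then show ?thesis by (simp add: f_def zeta_corr_def algebra_simps)
qed

lemma summable_powr_Suc: "e > 0 \<Longrightarrow> summable (\<lambda>n. real (Suc n) powr (- e - 1))"
  using summable_real_powr_iff[of "- e - 1"] by (subst summable_Suc_iff) simp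

lemma zeta_right_holomorphic: "zeta_right holomorphic_on {s. Re s > 0}"
proof -
  have "(\<lambda>s. \<Sum>n. zeta_corr n s) holomorphic_on {s. Re s > 0}"
  proof (rule holomorphic_uniform_sequence)
    show "open {s. Re s > 0}" by (rule open_halfspace_Re_gt)
    show "(\<lambda>s. \<Sum>i<n. zeta_corr i s) holomorphic_on {s. Re s > 0}" for n
      unfolding zeta_corr_def by (intro holomorphic_intros)
    fix x assume "x \<in> {s. Re s > 0}"
    then have x: "Re x > 0" by simp
    \<comment> \<open>Half the distance to the imaginary axis, so that \<open>Re s\<close> stays at
      least \<open>d\<close> on the whole closed disc.\<close>
    define d where "d = Re x / 2"
    have d: "d > 0" using x by (simp add: d_def)
    have Re: "Re s \<ge> d" if "s \<in> cball x d" for s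
      using that abs_Re_le_cmod[of "x - s"] by (auto simp: dist_norm d_def)
    define K where "K = (norm x + d + 1)\<^sup>2"
    have "uniform_limit (cball x d) (\<lambda>n s. \<Sum>i<n. zeta_corr i s) (\<lambda>s. \<Sum>n. zeta_corr n s) sequentially"
    proof (rule Weierstrass_m_test)
      show "summable (\<lambda>n. K * real (Suc n) powr (- d - 1))"
        by (intro summable_mult summable_powr_Suc d)
      fix n s assume s: "s \<in> cball x d"
      have "norm s \<le> norm x + d" using s norm_triangle_ineq[of x "s - x"]
        by (auto simp: dist_norm norm_minus_commute)
      moreover have "norm (1 - s) \<le> 1 + norm s" using norm_triangle_ineq4[of 1 s] by simp
      ultimately have "norm (1 - s) * norm s \<le> K"
        unfolding K_def power2_eq_square using d by (intro mult_mono) auto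
      moreover have "real (Suc n) powr (- Re s - 1) \<le> real (Suc n) powr (- d - 1)"
        using Re[OF s] by (intro powr_mono) auto
      ultimately have "norm (1 - s) * norm s * real (Suc n) powr (- Re s - 1) \<le> K * real (Suc n) powr (- d - 1)"
        by (intro mult_mono) (auto simp: K_def)
      with norm_zeta_corr_le[of s n] Re[OF s] d
      show "norm (zeta_corr n s) \<le> K * real (Suc n) powr (- d - 1)" by simp
    qed
    with d Re show "\<exists>d>0. cball x d \<subseteq> {s. Re s > 0} \<and>
        uniform_limit (cball x d) (\<lambda>n s. \<Sum>i<n. zeta_corr i s) (\<lambda>s. \<Sum>n. zeta_corr n s) sequentially"
      by (intro exI[of _ d]) force
  qed
  then show ?thesis
    unfolding zeta_right_def[abs_def] by (intro holomorphic_intros)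
qed

lemma zeta_right_1: "zeta_right 1 = 1"
proof -
  have "zeta_corr n 1 = 0" for n
    by (simp add: zeta_corr_def powr_0 del: of_nat_Suc)
  then show ?thesis by (simp add: zeta_right_def)
qed

text \<open>The differences of \<open>powr (1 - s)\<close> telescope; the leading 1 of
  \<open>zeta_right\<close> matches the value \<open>1 powr (1 - s)\<close> left at
  \<open>N = 0\<close>.\<close>

lemma zeta_right_limit:
  assumes s: "Re s > 0"
  shows "(\<lambda>N. (s - 1) * (\<Sum>n<N. of_nat (Suc n) powr - s) + of_nat (Suc N) powr (1 - s)) \<longlonglongrightarrow> zeta_right s"
proof -
  have "summable (\<lambda>n. zeta_corr n s)"
    by (rule summable_comparison_test'[OF summable_mult[OF summable_powr_Suc[OF s]] norm_zeta_corr_le[OF s]])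
  then have "(\<lambda>N. 1 + (\<Sum>n<N. zeta_corr n s)) \<longlonglongrightarrow> zeta_right s"
    unfolding zeta_right_def by (intro tendsto_intros summable_LIMSEQ)
  moreover have "1 + (\<Sum>n<N. zeta_corr n s) =
      (s - 1) * (\<Sum>n<N. of_nat (Suc n) powr - s) + of_nat (Suc N) powr (1 - s)" for N
    by (induction N) (auto simp: zeta_corr_def algebra_simps)
  ultimately show ?thesis by simp
qed

lemma zeta_right_sums:
  assumes s: "Re s > 1"
  shows "(\<lambda>n. 1 / of_nat (Suc n) powr s) sums (zeta_right s / (s - 1))"
proof -
  have s1: "s \<noteq> 1" using s by auto
  have "(\<lambda>N. norm (of_nat (Suc N) powr (1 - s))) \<longlonglongrightarrow> 0"
  proof -
    have "norm (of_nat (Suc N) powr (1 - s)) = real (Suc N) powr (1 - Re s)" for N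
      by (subst norm_powr_real_powr) auto
    moreover have "(\<lambda>N. real (Suc N) powr (1 - Re s)) \<longlonglongrightarrow> 0"
      using s by real_asymp
    ultimately show ?thesis by simp
  qed
  then have "(\<lambda>N. of_nat (Suc N) powr (1 - s)) \<longlonglongrightarrow> 0"
    by (rule tendsto_norm_zero_cancel)
  from tendsto_diff[OF zeta_right_limit[of s] this] s
  have "(\<lambda>N. (s - 1) * (\<Sum>n<N. of_nat (Suc n) powr - s)) \<longlonglongrightarrow> zeta_right s"
    by simp
  from tendsto_divide[OF this tendsto_const, of "s - 1"] s1
  have "(\<lambda>N. (\<Sum>n<N. of_nat (Suc n) powr - s)) \<longlonglongrightarrow> zeta_right s / (s - 1)"
    by simp
  then show ?thesis
    by (simp add: sums_def powr_minus divide_inverse)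
qed

lemma zeta_right_real:
  fixes s :: real
  assumes s: "0 < s" "s < 1"
  obtains z where "(\<lambda>N. (\<Sum>n<N. real (Suc n) powr - s) - real N powr (1 - s) / (1 - s)) \<longlonglongrightarrow> z"
    and "zeta_right (of_real s) = of_real ((s - 1) * z)"
proof -
  define a where "a N = (s - 1) * (\<Sum>n<N. real (Suc n) powr - s) + real (Suc N) powr (1 - s)" for N
  have pw: "of_nat (Suc n) powr complex_of_real r = of_real (real (Suc n) powr r)" for n r
    using powr_of_real[of "real (Suc n)" r] by simp
  have pw': "of_nat (Suc n) powr - complex_of_real s = of_real (real (Suc n) powr - s)"
    "of_nat (Suc n) powr (1 - complex_of_real s) = of_real (real (Suc n) powr (1 - s))" for n
    using pw[of n "- s"] pw[of n "1 - s"] by (simp_all del: of_nat_Suc)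
  have lim: "(\<lambda>N. complex_of_real (a N)) \<longlonglongrightarrow> zeta_right (of_real s)"
    using zeta_right_limit[of "of_real s"] s
    by (simp only: a_def pw' of_real_add of_real_mult of_real_diff of_real_1 of_real_sum Re_complex_of_real)
  have aR: "a \<longlonglongrightarrow> Re (zeta_right (of_real s))" using tendsto_Re[OF lim] by simp
  from tendsto_of_real[OF this] have "(\<lambda>N. complex_of_real (a N)) \<longlonglongrightarrow> of_real (Re (zeta_right (of_real s)))" .
  with lim have z: "zeta_right (of_real s) = of_real (Re (zeta_right (of_real s)))"
    using LIMSEQ_unique by blast
  define z where "z = Re (zeta_right (of_real s)) / (s - 1)"
  \<comment> \<open>This shifts the compensating term from \<open>Suc N\<close> to \<open>N\<close>;
    the correction tends to 0 because the exponent \<open>1 - s\<close> is below 1.\<close>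
  have "(\<lambda>N. (a N - (real (Suc N) powr (1 - s) - real N powr (1 - s))) / (s - 1)) \<longlonglongrightarrow>
      (Re (zeta_right (of_real s)) - 0) / (s - 1)"
  proof (intro tendsto_intros aR)
    show "(\<lambda>N. real (Suc N) powr (1 - s) - real N powr (1 - s)) \<longlonglongrightarrow> 0"
      using s by real_asymp
  qed (use s in auto)
  moreover have "(a N - (real (Suc N) powr (1 - s) - real N powr (1 - s))) / (s - 1) =
      (\<Sum>n<N. real (Suc n) powr - s) - real N powr (1 - s) / (1 - s)" for N
    using s by (simp add: a_def divide_simps) (simp add: algebra_simps)
  ultimately have "(\<lambda>N. (\<Sum>n<N. real (Suc n) powr - s) - real N powr (1 - s) / (1 - s)) \<longlonglongrightarrow> z"
    by (simp add: z_def)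
  moreover have "zeta_right (of_real s) = of_real ((s - 1) * z)"
    by (subst z) (use s in \<open>simp add: z_def\<close>)
  ultimately show ?thesis using that by blast
qed

text \<open>Written with \<open>rGamma\<close>, which is entire, so that neither the zero of the sine at 0 nor the poles
  of \<open>Gamma\<close> need to be removed by hand.\<close>

definition zeta_factor :: "complex \<Rightarrow> complex" where
  "zeta_factor s = of_real pi * of_real (2 * pi) powr (s - 1) *
     rGamma (1 + s / 2) * rGamma (1 - s / 2) * Gamma (2 - s)"

text \<open>Reflection at \<open>s / 2\<close> turns the two \<open>rGamma\<close> factors into a
  sine. Reflection at \<open>s\<close> and the double-angle formula then combine it with
  \<open>Gamma (2 - s)\<close> and the cosine to give \<open>(1 - s) * rGamma s\<close>.\<close>

lemma zeta_factor_eq: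
  assumes s: "s \<notin> \<int>"
  shows "zeta_factor s * (s * cos (of_real pi * s / 2)) =
     of_real pi * of_real (2 * pi) powr (s - 1) * ((1 - s) * rGamma s)"
proof -
  have "s \<noteq> 0" using s by auto
  have s1: "1 - s \<notin> \<int>\<^sub>\<le>\<^sub>0" using s nonpos_Ints_Int Ints_diff[of 1 "1 - s"] by auto
  have 1: "s / 2 * (rGamma (1 + s / 2) * rGamma (1 - s / 2)) = sin (of_real pi * s / 2) / of_real pi"
    using rGamma_plus1[of "s / 2"] rGamma_reflection_complex[of "s / 2"]
    by (simp add: add.commute flip: mult.assoc)
  have "Gamma (2 - s) = (1 - s) * Gamma (1 - s)"
    using Gamma_plus1[OF s1] by (simp add: algebra_simps)
  moreover have "rGamma s * (rGamma (1 - s) * Gamma (1 - s)) = Gamma (1 - s) * (sin (of_real pi * s) / of_real pi)"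
    by (simp flip: rGamma_reflection_complex)
  moreover have "rGamma (1 - s) * Gamma (1 - s) = 1"
    using s1 by (simp add: rGamma_inverse_Gamma Gamma_eq_zero_iff)
  moreover have "sin (of_real pi * s) = 2 * sin (of_real pi * s / 2) * cos (of_real pi * s / 2)"
    using sin_double[of "of_real pi * s / 2"] by simp
  ultimately have 2: "Gamma (2 - s) * (2 * (sin (of_real pi * s / 2) / of_real pi)) * cos (of_real pi * s / 2) =
      (1 - s) * rGamma s"
    by (simp add: mult_ac)
  have "zeta_factor s * (s * cos (of_real pi * s / 2)) =
    of_real pi * of_real (2 * pi) powr (s - 1) * (Gamma (2 - s) *
     (2 * (s / 2 * (rGamma (1 + s / 2) * rGamma (1 - s / 2)))) * cos (of_real pi * s / 2))"
    by (simp add: zeta_factor_def)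
  also have "\<dots> = of_real pi * of_real (2 * pi) powr (s - 1) * ((1 - s) * rGamma s)"
    unfolding 1 2 ..
  finally show ?thesis .
qed

lemma zeta_right_functional_equation_real:
  fixes s :: real
  assumes s: "0 < s" "s < 1"
  shows "zeta_right (of_real s) = zeta_factor (of_real s) * zeta_right (1 - of_real s)"
proof -
  obtain z where z: "(\<lambda>N. (\<Sum>n<N. real (Suc n) powr - s) - real N powr (1 - s) / (1 - s)) \<longlonglongrightarrow> z"
    "zeta_right (of_real s) = of_real ((s - 1) * z)"
    using zeta_right_real[OF s] by blast
  obtain z' where z': "(\<lambda>N. (\<Sum>n<N. real (Suc n) powr - (1 - s)) - real N powr (1 - (1 - s)) / (1 - (1 - s))) \<longlonglongrightarrow> z'"
    "zeta_right (of_real (1 - s)) = of_real ((1 - s - 1) * z')"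
    using zeta_right_real[of "1 - s"] s by auto
  define C where "C = cos (pi * s / 2)"
  have C: "C > 0"
  proof -
    have "0 < pi * s" "pi * s < pi" using s by auto
    then have "- (pi / 2) < pi * s / 2" "pi * s / 2 < pi / 2"
      using pi_gt_zero by linarith+
    then show ?thesis unfolding C_def by (rule cos_gt_zero_pi)
  qed
  have "Gamma s > 0" using s by (intro Gamma_real_pos)
  have sI: "complex_of_real s \<notin> \<int>"
  proof
    assume "complex_of_real s \<in> \<int>"
    then obtain n where "complex_of_real s = of_int n" by (auto elim: Ints_cases)
    then have "s = of_int n" by (metis of_real_eq_iff of_real_of_int_eq)
    with s have "0 < n" "n < 1" by auto
    then show False by linarith
  qed
  have "Gamma s * z = pi / C * (2 * pi) powr (s - 1) * z'"
    unfolding C_def by (rule zeta_functional_equation_limits[OF s]) (use z z' in simp_all)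
  moreover have "z = Gamma s * z / Gamma s" using \<open>Gamma s > 0\<close> by simp
  ultimately have "z = pi / C * (2 * pi) powr (s - 1) * z' / Gamma s" by metis
  \<comment> \<open>The factor \<open>s - 1\<close> produces \<open>zeta_right\<close> at
    \<open>s\<close>; the factor \<open>s\<close>, up to sign, is the corresponding factor at
    \<open>1 - s\<close>.\<close>
  then have "(s - 1) * z * (s * C) = (s - 1) * (pi / C * (2 * pi) powr (s - 1) * z' / Gamma s) * (s * C)"
    by simp
  also have "\<dots> = pi * (2 * pi) powr (s - 1) * ((1 - s) * (1 / Gamma s)) * ((1 - s - 1) * z')"
    using C by (simp add: divide_simps) (simp add: algebra_simps)
  finally have "(s - 1) * z * (s * C) = pi * (2 * pi) powr (s - 1) * ((1 - s) * (1 / Gamma s)) * ((1 - s - 1) * z')" .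
  then have "complex_of_real ((s - 1) * z * (s * C)) =
      of_real (pi * (2 * pi) powr (s - 1) * ((1 - s) * (1 / Gamma s)) * ((1 - s - 1) * z'))"
    by (rule arg_cong)
  then have "zeta_right (of_real s) * (of_real s * of_real C) =
     of_real pi * of_real ((2 * pi) powr (s - 1)) * ((1 - of_real s) * rGamma (of_real s)) * zeta_right (1 - of_real s)"
    using z(2) z'(2) by (simp add: rGamma_inverse_Gamma Gamma_complex_of_real divide_inverse)
  also have "complex_of_real ((2 * pi) powr (s - 1)) = of_real (2 * pi) powr (of_real s - 1)"
    using powr_of_real[of "2 * pi" "s - 1"] by simp
  also have "of_real pi * of_real (2 * pi) powr (of_real s - 1) * ((1 - of_real s) * rGamma (of_real s)) =
      zeta_factor (of_real s) * (of_real s * cos (of_real pi * of_real s / 2))"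
    by (rule zeta_factor_eq[OF sI, symmetric])
  also have "cos (of_real pi * of_real s / 2) = complex_of_real C"
    unfolding C_def by (simp flip: cos_of_real)
  finally have "zeta_right (of_real s) * (of_real s * of_real C) =
      (zeta_factor (of_real s) * zeta_right (1 - of_real s)) * (of_real s * of_real C)"
    by (simp add: mult_ac)
  then show ?thesis using s C by simp
qed

lemma zeta_factor_holomorphic: "zeta_factor holomorphic_on {s. Re s < 2}"
  unfolding zeta_factor_def[abs_def]
  by (intro holomorphic_intros) (auto elim!: nonpos_Ints_cases simp: complex_eq_iff)

text \<open>For \<open>Re s < 2\<close> the arguments \<open>1 - s / 2\<close> and
  \<open>2 - s\<close> have positive real part, so only \<open>rGamma (1 + s / 2)\<close> can
  vanish. Its zeros are the trivial zeros of zeta.\<close>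

lemma zeta_factor_eq_0_iff:
  assumes "Re s < 2"
  shows "zeta_factor s = 0 \<longleftrightarrow> s \<in> range (\<lambda>n. - 2 * of_nat (Suc n))"
proof -
  have "1 - s / 2 \<notin> \<int>\<^sub>\<le>\<^sub>0" "2 - s \<notin> \<int>\<^sub>\<le>\<^sub>0"
    using assms by (auto elim!: nonpos_Ints_cases simp: complex_eq_iff)
  then have "zeta_factor s = 0 \<longleftrightarrow> 1 + s / 2 \<in> \<int>\<^sub>\<le>\<^sub>0"
    by (simp add: zeta_factor_def rGamma_eq_zero_iff Gamma_eq_zero_iff)
  also have "\<dots> \<longleftrightarrow> (\<exists>n. 1 + s / 2 = - of_nat n)"
    by (auto elim!: nonpos_Ints_cases')
  also have "\<dots> \<longleftrightarrow> s \<in> range (\<lambda>n. - 2 * of_nat (Suc n))"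
  proof -
    have "1 + s / 2 = - of_nat n \<longleftrightarrow> s = - 2 * of_nat (Suc n)" for n
    proof
      assume "1 + s / 2 = - of_nat n"
      moreover have "s = 2 * (1 + s / 2) - 2" by simp
      ultimately have "s = 2 * (- of_nat n) - 2" by metis
      then show "s = - 2 * of_nat (Suc n)" by simp
    next
      assume "s = - 2 * of_nat (Suc n)"
      then show "1 + s / 2 = - of_nat n" by (simp only:) (simp add: field_simps)
    qed
    then show ?thesis by auto
  qed
  finally show ?thesis .
qed

lemma zeta_right_functional_equation:
  assumes s: "0 < Re s" "Re s < 1"
  shows "zeta_right s = zeta_factor s * zeta_right (1 - s)"
proof -
  define S where "S = {s. 0 < Re s} \<inter> {s. Re s < 1}"
  have "zeta_right s - zeta_factor s * zeta_right (1 - s) = 0"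
  proof (rule analytic_continuation[of "\<lambda>s. zeta_right s - zeta_factor s * zeta_right (1 - s)" S
        "complex_of_real ` {0<..<1}" "1 / 2"])
    show "open S" unfolding S_def by (intro open_Int open_halfspace_Re_gt open_halfspace_Re_lt)
    show "connected S" unfolding S_def
      by (intro convex_connected convex_Int convex_halfspace_Re_gt convex_halfspace_Re_lt)
    have "zeta_right holomorphic_on S" "zeta_factor holomorphic_on S"
      by (rule holomorphic_on_subset[OF zeta_right_holomorphic], force simp: S_def)
         (rule holomorphic_on_subset[OF zeta_factor_holomorphic], force simp: S_def)
    moreover have "(\<lambda>s. zeta_right (1 - s)) holomorphic_on S"
      by (rule holomorphic_on_compose_gen[OF _ zeta_right_holomorphic, unfolded o_def])
         (auto intro!: holomorphic_intros simp: S_def)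
    ultimately show "(\<lambda>s. zeta_right s - zeta_factor s * zeta_right (1 - s)) holomorphic_on S"
      by (intro holomorphic_intros)
    show "(1 / 2) islimpt complex_of_real ` {0<..<1}"
      unfolding islimpt_approachable
    proof (intro allI impI)
      fix e :: real assume e: "e > 0"
      define t where "t = min (e / 2) (1 / 4)"
      have t: "0 < t" "t < e" "t < 1 / 2" using e by (auto simp: t_def)
      have "1 / 2 = complex_of_real (1 / 2)" by simp
      then have "dist (complex_of_real (1 / 2 + t)) (1 / 2) = t"
        using t by (simp only: dist_of_real) (simp add: dist_real_def)
      moreover have "complex_of_real (1 / 2 + t) \<in> of_real ` {0<..<1}"
        using t by (intro imageI) auto
      ultimately show "\<exists>x'\<in>complex_of_real ` {0<..<1}. x' \<noteq> 1 / 2 \<and> dist x' (1 / 2) < e"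
        using t by (metis dist_self less_irrefl)
    qed
    show "zeta_right w - zeta_factor w * zeta_right (1 - w) = 0" if "w \<in> complex_of_real ` {0<..<1}" for w
      using that by (auto simp: zeta_right_functional_equation_real[symmetric])
  qed (use s in \<open>auto simp: S_def\<close>)
  then show ?thesis by simp
qed

text \<open>The entire function \<open>(s - 1) * zeta s\<close>. The two branches agree on the strip
  \<open>0 < Re s < 1\<close> by the functional equation.\<close>

definition zeta_entire :: "complex \<Rightarrow> complex" where
  "zeta_entire s = (if Re s > 0 then zeta_right s else zeta_factor s * zeta_right (1 - s))"

lemma zeta_entire_functional_equation:
  assumes "Re s < 1"
  shows "zeta_entire s = zeta_factor s * zeta_entire (1 - s)"
  using assms zeta_right_functional_equation[of s] by (cases "Re s > 0") (simp_all add: zeta_entire_def)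

lemma zeta_entire_holomorphic: "zeta_entire holomorphic_on A"
proof -
  have "(\<lambda>s. if s \<in> {s. Re s > 0} then zeta_right s else zeta_factor s * zeta_right (1 - s))
      holomorphic_on ({s. Re s > 0} \<union> {s. Re s < 1})"
  proof (rule holomorphic_on_If_Un)
    have "zeta_factor holomorphic_on {s. Re s < 1}"
      by (rule holomorphic_on_subset[OF zeta_factor_holomorphic]) auto
    moreover have "(\<lambda>s. zeta_right (1 - s)) holomorphic_on {s. Re s < 1}"
      by (rule holomorphic_on_compose_gen[OF _ zeta_right_holomorphic, unfolded o_def])
         (auto intro!: holomorphic_intros)
    ultimately show "(\<lambda>s. zeta_factor s * zeta_right (1 - s)) holomorphic_on {s. Re s < 1}"
      by (intro holomorphic_intros)
    show "zeta_right s = zeta_factor s * zeta_right (1 - s)" if "s \<in> {s. Re s > 0}" "s \<in> {s. Re s < 1}" for s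
      using that by (intro zeta_right_functional_equation) auto
  qed (auto intro: zeta_right_holomorphic open_halfspace_Re_gt open_halfspace_Re_lt)
  moreover have "{s. Re s > 0} \<union> {s. Re s < 1} = UNIV" by auto
  ultimately have "zeta_entire holomorphic_on UNIV"
    by (simp add: zeta_entire_def[abs_def])
  then show ?thesis by (rule holomorphic_on_subset) simp
qed

lemma zeta_entire_1: "zeta_entire 1 = 1"
  by (simp add: zeta_entire_def zeta_right_1)

text \<open>The functional equation relates this value to the one at 1. It keeps zeros of zeta away
  from the origin, where the division by \<open>z\<close> in the Newton quotient would
  matter.\<close>

lemma zeta_entire_0: "zeta_entire 0 \<noteq> 0"
proof -
  have "(0::complex) \<notin> range (\<lambda>n. - 2 * of_nat (Suc n))"
    by (auto simp del: of_nat_Suc)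
  then show ?thesis
    using zeta_entire_functional_equation[of 0] zeta_factor_eq_0_iff[of 0] by (simp add: zeta_entire_1)
qed

lemma zeta_eq: "zeta s = zeta_entire s / (s - 1)"
proof -
  have "(\<lambda>s. zeta_entire s / (s - 1)) nicely_meromorphic_on UNIV"
    unfolding nicely_meromorphic_on_def
  proof (intro conjI ballI)
    show "(\<lambda>s. zeta_entire s / (s - 1)) meromorphic_on UNIV"
      by (intro meromorphic_intros analytic_on_imp_meromorphic_on)
         (auto simp: analytic_on_open zeta_entire_holomorphic)
    fix z
    show "is_pole (\<lambda>s. zeta_entire s / (s - 1)) z \<and> zeta_entire z / (z - 1) = 0 \<or>
        (\<lambda>s. zeta_entire s / (s - 1)) \<midarrow>z\<rightarrow> zeta_entire z / (z - 1)"
    proof (cases "z = 1")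
      \<comment> \<open>At 1 the quotient is a division by zero, so its HOL value 0 is the one that
        nice meromorphy prescribes at a pole.\<close>
      case True
      have "is_pole (\<lambda>s. zeta_entire s / (s - 1) ^ 1) 1"
        by (rule is_pole_basic[of _ UNIV]) (auto simp: zeta_entire_holomorphic zeta_entire_1)
      then show ?thesis using True by simp
    next
      case False
      have "isCont zeta_entire z"
        using holomorphic_on_imp_continuous_on[OF zeta_entire_holomorphic[of UNIV]]
        by (simp add: continuous_on_eq_continuous_at)
      then have "isCont (\<lambda>s. zeta_entire s / (s - 1)) z"
        using False by (intro continuous_intros) auto
      then show ?thesis by (simp add: isCont_def)
    qed
  qed
  then have zeta: "zeta = (\<lambda>s. zeta_entire s / (s - 1))"
    by (rule zeta_unique) (use zeta_right_sums in \<open>auto simp: zeta_entire_def simp del: of_nat_Suc\<close>)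
  show ?thesis unfolding zeta ..
qed

section \<open>Fixed points of the Newton-like map\<close>

text \<open>The identification holds on a whole neighbourhood, as the multiplier is a derivative: at
  a point other than \<open>a\<close>, a smaller punctured disc avoids \<open>a\<close>.\<close>

lemma sphere_map_removable:
  assumes ev: "\<forall>\<^sub>F z in at a. f z = F z" and F: "F analytic_on {a}"
  shows "\<forall>\<^sub>F z in nhds a. sphere_map f z = Some (F z)"
    and "sphere_map f a = Some (F a)" and "multiplier (sphere_map f) a = deriv F a"
proof -
  obtain r1 where r1: "r1 > 0" "\<And>z. z \<noteq> a \<Longrightarrow> dist z a < r1 \<Longrightarrow> f z = F z"
    using ev unfolding eventually_at by blast
  obtain r2 where r2: "r2 > 0" "F holomorphic_on ball a r2"
    using F by (auto simp: analytic_on_def)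
  define r where "r = min r1 r2"
  have sm: "sphere_map f z = Some (F z)" if z: "z \<in> ball a r" for z
  proof -
    have "F analytic_on {z}"
      using r2 z by (intro analytic_at[THEN iffD2] exI[of _ "ball a r2"]) (auto simp: r_def)
    then have Fz: "\<not> is_pole F z" "F \<midarrow>z\<rightarrow> F z"
      by (auto simp: analytic_at_imp_no_pole analytic_at_imp_isCont isContD)
    have ev': "\<forall>\<^sub>F w in at z. f w = F w"
    proof (cases "z = a")
      case False
      have "\<forall>\<^sub>F w in at z. w \<in> ball a r - {a}"
        using False z by (intro eventually_at_in_open') auto
      then show ?thesis by eventually_elim (use r1 in \<open>auto simp: r_def dist_commute\<close>)
    qed (use ev in simp)
    have "is_pole f z = is_pole F z" "(f \<midarrow>z\<rightarrow> F z) = (F \<midarrow>z\<rightarrow> F z)"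
      by (rule is_pole_cong[OF ev' refl], rule tendsto_cong[OF ev'])
    then show ?thesis using Fz by (simp add: sphere_map_def remove_sings_eqI)
  qed
  have "r > 0" using r1 r2 by (simp add: r_def)
  then show "\<forall>\<^sub>F z in nhds a. sphere_map f z = Some (F z)"
    by (intro eventually_nhds_in_open[of "ball a r" a, THEN eventually_mono] sm) auto
  then have "\<forall>\<^sub>F z in nhds a. the (sphere_map f z) = F z"
    by eventually_elim simp
  then show "multiplier (sphere_map f) a = deriv F a"
    unfolding multiplier_def by (rule deriv_cong_ev) simp
  show "sphere_map f a = Some (F a)" using \<open>r > 0\<close> by (intro sm) simp
qed

lemma sphere_map_fixed_point:
  assumes ev: "\<forall>\<^sub>F z in at a. f z = z - (z - a) * k z" and k: "k analytic_on {a}"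
  shows "sphere_map f a = Some a" and "multiplier (sphere_map f) a = 1 - k a"
proof -
  have an: "(\<lambda>z. z - (z - a) * k z) analytic_on {a}"
    by (intro analytic_intros k)
  show "sphere_map f a = Some a"
    using sphere_map_removable(2)[OF ev an] by simp
  have "(k has_field_derivative deriv k a) (at a)"
    using k analytic_on_imp_differentiable_at DERIV_deriv_iff_field_differentiable by blast
  then have "((\<lambda>z. z - (z - a) * k z) has_field_derivative (1 - k a)) (at a)"
    by (auto intro!: derivative_eq_intros)
  then show "multiplier (sphere_map f) a = 1 - k a"
    using sphere_map_removable(3)[OF ev an] DERIV_imp_deriv by metis
qed

text \<open>Away from 1 this is \<open>(z - 1)^2 * deriv zeta z\<close>, the derivative of zeta with
  its double pole cleared.\<close>

definition nu_denom :: "complex \<Rightarrow> complex" where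
  "nu_denom z = deriv zeta_entire z * (z - 1) - zeta_entire z"

lemma zeta_entire_has_deriv: "(zeta_entire has_field_derivative deriv zeta_entire z) (at z)"
  using zeta_entire_holomorphic[of UNIV] holomorphic_derivI open_UNIV by blast

lemma zeta_entire_analytic: "zeta_entire analytic_on A"
  using analytic_on_subset[of zeta_entire UNIV A] by (simp add: analytic_on_open zeta_entire_holomorphic)

lemma nu_denom_analytic: "nu_denom analytic_on A"
  unfolding nu_denom_def[abs_def] by (intro analytic_intros analytic_deriv zeta_entire_analytic)

lemma nu_denom_1: "nu_denom 1 = -1"
  by (simp add: nu_denom_def zeta_entire_1)

text \<open>The identity holds even at 0, at 1 and at zeros of \<open>nu_denom\<close>, since both
  sides take the default value 0 there.\<close>

lemma newton_quotient_eq: "zeta z / (z * deriv zeta z) = zeta_entire z * (z - 1) / (z * nu_denom z)"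
proof (cases "z = 1")
  case False
  have "((\<lambda>s. zeta_entire s / (s - 1)) has_field_derivative
      (deriv zeta_entire z * (z - 1) - zeta_entire z * 1) / ((z - 1) * (z - 1))) (at z)"
    using False by (intro DERIV_divide zeta_entire_has_deriv) (auto intro!: derivative_eq_intros)
  then have D: "deriv zeta z = nu_denom z / ((z - 1) * (z - 1))"
    unfolding zeta_eq[abs_def] nu_denom_def using DERIV_imp_deriv by fastforce
  show ?thesis
    using False by (cases "z = 0 \<or> nu_denom z = 0") (auto simp: zeta_eq D field_simps)
qed (simp add: zeta_eq)

lemma nu_zeta_eq: "nu_zeta = sphere_map (\<lambda>z. z - zeta_entire z * (z - 1) / (z * nu_denom z))"
  unfolding nu_zeta_def newton_quotient_eq ..

lemma nu_zeta_1: "multiplier nu_zeta 1 = 2"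
proof -
  have "(\<lambda>z. zeta_entire z / (z * nu_denom z)) analytic_on {1}"
    by (intro analytic_intros zeta_entire_analytic nu_denom_analytic) (auto simp: nu_denom_1)
  then show ?thesis
    unfolding nu_zeta_eq
    by (subst sphere_map_fixed_point(2)[where k = "\<lambda>z. zeta_entire z / (z * nu_denom z)"])
       (auto simp: nu_denom_1 zeta_entire_1 mult_ac)
qed

text \<open>Writing \<open>zeta_entire\<close> as \<open>(z - a) ^ m * g z\<close>, the power
  \<open>(z - a) ^ (m - 1)\<close> cancels in the Newton quotient and a simple factor
  \<open>z - a\<close> remains.\<close>

lemma nu_zeta_at_zero:
  assumes a: "zeta_entire a = 0"
  obtains m :: nat where "m > 0" "zorder zeta a = int m"
    "nu_zeta a = Some a" "multiplier nu_zeta a = 1 - 1 / (of_nat m * a)"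
proof -
  have a01: "a \<noteq> 0" "a \<noteq> 1" using a zeta_entire_0 zeta_entire_1 by auto
  have nc: "\<not> zeta_entire constant_on UNIV"
    using a zeta_entire_1 unfolding constant_on_def by (metis UNIV_I zero_neq_one)
  obtain g r m where m: "0 < m" and r: "0 < r" and "ball a r \<subseteq> UNIV" and g: "g holomorphic_on ball a r"
    and E: "\<And>w. w \<in> ball a r \<Longrightarrow> zeta_entire w = (w - a) ^ m * g w"
    and g0: "\<And>w. w \<in> ball a r \<Longrightarrow> g w \<noteq> 0"
    by (rule holomorphic_factor_zero_nonconstant[OF zeta_entire_holomorphic open_UNIV connected_UNIV UNIV_I a nc]) (rule that)
  have "zorder zeta a = int m"
  proof (rule zorder_eqI)
    show "open (ball a r - {1})" "a \<in> ball a r - {1}" using r a01 by auto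
    show "(\<lambda>w. g w / (w - 1)) holomorphic_on ball a r - {1}"
      using g by (intro holomorphic_intros) (auto intro: holomorphic_on_subset)
    show "g a / (a - 1) \<noteq> 0" using g0 r a01 by simp
    show "zeta w = g w / (w - 1) * (w - a) powi int m" if "w \<in> ball a r - {1}" "w \<noteq> a" for w
      using that E by (simp add: zeta_eq)
  qed
  \<comment> \<open>\<open>nu_denom\<close> divided by \<open>(z - a) ^ (m - 1)\<close>; its value
    at \<open>a\<close> is \<open>m * g a * (a - 1)\<close>.\<close>
  define d where "d z = (of_nat m * g z + (z - a) * deriv g z) * (z - 1) - (z - a) * g z" for z
  define k where "k z = g z * (z - 1) / (z * d z)" for z
  have gan: "g analytic_on {a}" using g r by (auto simp: analytic_at intro!: exI[of _ "ball a r"])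
  have da: "d a \<noteq> 0" using g0[of a] r a01 m by (simp add: d_def)
  have k: "k analytic_on {a}"
    unfolding k_def[abs_def] using da a01
    by (auto intro!: analytic_intros gan) (auto simp: d_def[abs_def] intro!: analytic_intros analytic_deriv gan)
  have "\<forall>\<^sub>F z in at a. z \<in> ball a r - {a}"
    using r by (intro eventually_at_in_open) auto
  then have "\<forall>\<^sub>F z in at a. z - zeta_entire z * (z - 1) / (z * nu_denom z) = z - (z - a) * k z"
  proof eventually_elim
    case (elim z)
    have "((\<lambda>w. (w - a) ^ m * g w) has_field_derivative
        (of_nat m * (z - a) ^ (m - 1)) * g z + deriv g z * (z - a) ^ m) (at z)"
      using elim g by (auto intro!: derivative_eq_intros holomorphic_derivI[of g "ball a r"])
    then have "(zeta_entire has_field_derivative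
        (of_nat m * (z - a) ^ (m - 1)) * g z + deriv g z * (z - a) ^ m) (at z)"
      by (rule has_field_derivative_transform_within_open[of _ _ _ "ball a r"]) (use elim E in auto)
    then have "deriv zeta_entire z = (of_nat m * (z - a) ^ (m - 1)) * g z + deriv g z * (z - a) ^ m"
      by (rule DERIV_imp_deriv)
    moreover have pw: "(z - a) ^ m = (z - a) ^ (m - 1) * (z - a)"
      using m by (metis power_minus_mult)
    moreover have Ez: "zeta_entire z = (z - a) ^ m * g z" using E elim by blast
    ultimately have "nu_denom z = (of_nat m * (z - a) ^ (m - 1) * g z + deriv g z * ((z - a) ^ (m - 1) * (z - a))) * (z - 1) -
        (z - a) ^ (m - 1) * (z - a) * g z"
      unfolding nu_denom_def by simp
    also have "\<dots> = (z - a) ^ (m - 1) * d z"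
      by (simp add: d_def algebra_simps)
    finally have "nu_denom z = (z - a) ^ (m - 1) * d z" .
    then show ?case
      using elim Ez unfolding k_def pw by simp
  qed
  note fp = sphere_map_fixed_point[OF this k]
  have "k a = 1 / (of_nat m * a)"
    using g0[of a] r a01 m by (simp add: k_def d_def)
  with fp show ?thesis
    using that[OF m \<open>zorder zeta a = int m\<close>] unfolding nu_zeta_eq by simp
qed

text \<open>If the numerator \<open>N\<close> does not vanish at \<open>a\<close>, the quotient is
  either finite and nonzero there or has a pole. The latter case includes the origin.\<close>

lemma nu_zeta_fixed_pointD:
  assumes "nu_zeta a = Some a" "a \<noteq> 1"
  shows "zeta_entire a = 0"
proof (rule ccontr)
  assume E: "zeta_entire a \<noteq> 0"
  define N where "N z = zeta_entire z * (z - 1)" for z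
  define Q where "Q z = z * nu_denom z" for z
  have N: "N analytic_on A" and Q: "Q analytic_on A" for A
    unfolding N_def[abs_def] Q_def[abs_def]
    by (intro analytic_intros zeta_entire_analytic nu_denom_analytic)+
  have Na: "N a \<noteq> 0" using E assms by (simp add: N_def)
  have nu: "nu_zeta = sphere_map (\<lambda>z. z - N z / Q z)"
    by (simp add: nu_zeta_eq N_def Q_def)
  show False
  proof (cases "Q a = 0")
    case False
    have "(\<lambda>z. z - N z / Q z) analytic_on {a}"
      using False by (intro analytic_intros N Q) auto
    from sphere_map_removable(2)[OF _ this] have "nu_zeta a = Some (a - N a / Q a)"
      unfolding nu by simp
    then show False using assms False Na by simp
  next
    case True
    have "Q holomorphic_on UNIV" using Q[of UNIV] by (rule analytic_imp_holomorphic)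
    \<comment> \<open>\<open>Q 1 = -1\<close> shows that \<open>Q\<close> is not identically zero,
      so its zero at \<open>a\<close> is isolated.\<close>
    then obtain r where r: "0 < r" "\<And>z. z \<in> ball a r - {a} \<Longrightarrow> Q z \<noteq> 0"
      using isolated_zeros[of Q UNIV a 1] True by (auto simp: Q_def nu_denom_1)
    have "\<forall>\<^sub>F z in at a. z \<in> ball a r - {a}"
      using r by (intro eventually_at_in_open) auto
    then have "\<forall>\<^sub>F z in at a. Q z \<noteq> 0" by eventually_elim (use r in auto)
    moreover have "isCont Q a" "isCont N a"
      using Q N analytic_at_imp_isCont by blast+
    ultimately have "filterlim Q (at 0) (at a)"
      using True by (auto simp: filterlim_at isCont_def)
    then have "is_pole (\<lambda>z. N z / Q z) a"
      using \<open>isCont N a\<close> Na by (intro is_pole_divide)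
    then have "filterlim (\<lambda>z. - (N z / Q z)) at_infinity (at a)"
      unfolding is_pole_def by (simp add: filterlim_at_infinity_conv_norm_at_top)
    then have "filterlim (\<lambda>z. z + - (N z / Q z)) at_infinity (at a)"
      by (intro tendsto_add_filterlim_at_infinity[of _ a] tendsto_intros)
    then have "is_pole (\<lambda>z. z - N z / Q z) a" by (simp add: is_pole_def)
    then show False using assms unfolding nu by (simp add: sphere_map_def)
  qed
qed

text \<open>The modulus is \<open>norm (c - 1) / norm c\<close>, which compares the distances of
  \<open>c\<close> to 1 and to 0; the line \<open>Re c = 1 / 2\<close> is their bisector.\<close>

lemma norm_one_minus_inverse:
  fixes c :: complex
  assumes "c \<noteq> 0"
  shows "norm (1 - 1 / c) < 1 \<longleftrightarrow> Re c > 1 / 2" and "norm (1 - 1 / c) = 1 \<longleftrightarrow> Re c = 1 / 2"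
proof -
  have n: "norm (1 - 1 / c) = norm (c - 1) / norm c"
    using assms by (simp add: field_simps flip: norm_divide)
  have sq: "(norm (c - 1))\<^sup>2 = (norm c)\<^sup>2 + 1 - 2 * Re c"
    unfolding cmod_power2 by (simp add: power2_eq_square algebra_simps)
  have "norm (1 - 1 / c) < 1 \<longleftrightarrow> norm (c - 1) < norm c"
    using assms by (simp add: n)
  also have "\<dots> \<longleftrightarrow> (norm (c - 1))\<^sup>2 < (norm c)\<^sup>2"
    by (simp flip: not_le)
  finally show "norm (1 - 1 / c) < 1 \<longleftrightarrow> Re c > 1 / 2" unfolding sq by auto
  have "norm (1 - 1 / c) = 1 \<longleftrightarrow> norm (c - 1) = norm c"
    using assms by (auto simp: n)
  also have "\<dots> \<longleftrightarrow> (norm (c - 1))\<^sup>2 = (norm c)\<^sup>2"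
    by simp
  finally show "norm (1 - 1 / c) = 1 \<longleftrightarrow> Re c = 1 / 2" unfolding sq by auto
qed

section \<open>Zeros of zeta read as fixed points\<close>

lemma zeta_zero_indifferent_iff:
  assumes a: "zeta_entire a = 0"
  shows "indifferent_fixed_point nu_zeta a \<longleftrightarrow> of_int (zorder zeta a) * Re a = 1 / 2"
    and "attracting_fixed_point nu_zeta a \<longleftrightarrow> of_int (zorder zeta a) * Re a > 1 / 2"
    and "zorder zeta a \<ge> 1"
proof -
  obtain m where m: "m > 0" "zorder zeta a = int m"
    "nu_zeta a = Some a" "multiplier nu_zeta a = 1 - 1 / (of_nat m * a)"
    using nu_zeta_at_zero[OF a] by blast
  have "of_nat m * a \<noteq> 0" using m a zeta_entire_0 by auto
  from norm_one_minus_inverse[OF this] m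
  show "indifferent_fixed_point nu_zeta a \<longleftrightarrow> of_int (zorder zeta a) * Re a = 1 / 2"
    "attracting_fixed_point nu_zeta a \<longleftrightarrow> of_int (zorder zeta a) * Re a > 1 / 2" "zorder zeta a \<ge> 1"
    by (auto simp: indifferent_fixed_point_def attracting_fixed_point_def fixed_point_def)
qed

lemma attracting_fixed_point_imp_zero:
  assumes "attracting_fixed_point nu_zeta a"
  shows "zeta_entire a = 0"
  using assms nu_zeta_1 nu_zeta_fixed_pointD[of a]
  by (cases "a = 1") (auto simp: attracting_fixed_point_def fixed_point_def)

lemma nontrivial_zeta_zero_iff:
  "nontrivial_zeta_zero s \<longleftrightarrow> zeta_entire s = 0 \<and> s \<notin> range (\<lambda>n. - 2 * of_nat (Suc n))"
proof -
  have "sphere_map zeta s = Some 0 \<longleftrightarrow> zeta_entire s = 0"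
  proof (cases "s = 1")
    case True
    have "is_pole (\<lambda>s. zeta_entire s / (s - 1) ^ 1) 1"
      by (rule is_pole_basic[of _ UNIV]) (auto simp: zeta_entire_holomorphic zeta_entire_1)
    then show ?thesis using True by (simp add: sphere_map_def zeta_eq[abs_def] zeta_entire_1)
  next
    case False
    then have "zeta analytic_on {s}"
      unfolding zeta_eq[abs_def] by (intro analytic_intros zeta_entire_analytic) auto
    from sphere_map_removable(2)[OF _ this, of zeta] show ?thesis
      using False by (simp add: zeta_eq)
  qed
  then show ?thesis by (simp add: nontrivial_zeta_zero_def)
qed

lemma no_attracting_imp_critical_simple:
  assumes no: "\<And>a. \<not> attracting_fixed_point nu_zeta a" and s: "nontrivial_zeta_zero s"
  shows "Re s = 1 / 2" and "zorder zeta s = 1"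
proof -
  have z: "zeta_entire s = 0" and nt: "s \<notin> range (\<lambda>n. - 2 * of_nat (Suc n))"
    using s by (auto simp: nontrivial_zeta_zero_iff)
  have le: "of_int (zorder zeta a) * Re a \<le> 1 / 2 \<and> zorder zeta a \<ge> 1 \<and> Re a \<le> 1 / 2"
    if "zeta_entire a = 0" for a
  proof -
    have 1: "of_int (zorder zeta a) * Re a \<le> 1 / 2" "zorder zeta a \<ge> 1"
      using no[of a] zeta_zero_indifferent_iff[OF that] by auto
    have "Re a \<le> 1 / 2"
    proof (cases "Re a > 0")
      case True
      \<comment> \<open>For positive real part, multiplying by an order of at least 1 only increases
        it.\<close>
      then have "1 * Re a \<le> of_int (zorder zeta a) * Re a"
        using 1(2) by (intro mult_right_mono) auto
      then show ?thesis using 1(1) by linarith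
    qed simp
    with 1 show ?thesis by simp
  qed
  have "Re s < 1" using le[OF z] by simp
  \<comment> \<open>Non-triviality of \<open>s\<close> means that the factor in the functional
    equation is nonzero, so the zero passes to \<open>1 - s\<close>.\<close>
  then have z': "zeta_entire (1 - s) = 0"
    using z nt zeta_entire_functional_equation[of s] zeta_factor_eq_0_iff[of s] by simp
  have Re: "Re s = 1 / 2" using le[OF z] le[OF z'] by simp
  then show "Re s = 1 / 2" .
  show "zorder zeta s = 1" using le[OF z] Re by simp
qed

section \<open>Disks mapped into themselves\<close>

text \<open>Brouwer needs a closed ball. The compact set \<open>K\<close> corresponds to a compact
  part of the open unit ball, hence lies in a smaller concentric closed ball, which the conjugated
  map sends into itself.\<close>

lemma homeomorphic_ball_fixed_point:
  fixes D :: "'a::t2_space set" and c :: "'b::euclidean_space"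
  assumes D: "D homeomorphic ball c 1" and g: "continuous_on D g"
    and K: "compact K" "K \<subseteq> D" "g ` D \<subseteq> K"
  obtains a where "a \<in> D" "g a = a"
proof -
  obtain p q where pq: "homeomorphism D (ball c 1) p q"
    using D unfolding homeomorphic_def by blast
  have p: "continuous_on D p" "p ` D = ball c 1" "\<And>x. x \<in> D \<Longrightarrow> q (p x) = x"
    and q: "continuous_on (ball c 1) q" "q ` ball c 1 = D" "\<And>y. y \<in> ball c 1 \<Longrightarrow> p (q y) = y"
    using pq by (auto simp: homeomorphism_def)
  have "compact (p ` K)"
    using K p by (intro compact_continuous_image) (auto intro: continuous_on_subset)
  moreover have "p ` K \<noteq> {}"
    using K(3) q(2) by auto
  moreover have "continuous_on (p ` K) (\<lambda>y. dist c y)"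
    by (intro continuous_intros)
  ultimately obtain x where x: "x \<in> p ` K" "\<And>y. y \<in> p ` K \<Longrightarrow> dist c y \<le> dist c x"
    using continuous_attains_sup by metis
  \<comment> \<open>The maximum with 1/2 keeps the radius positive when \<open>K\<close> corresponds
    to the centre alone.\<close>
  define r where "r = max (dist c x) (1 / 2)"
  have "x \<in> ball c 1" using x(1) K(2) p(2) by blast
  then have "dist c x < 1" by simp
  then have r: "0 < r" "r < 1" by (auto simp: r_def)
  have sub: "cball c r \<subseteq> ball c 1" using r by auto
  have pK: "p ` K \<subseteq> cball c r" using x(2) by (fastforce simp: r_def)
  obtain y where y: "y \<in> cball c r" "p (g (q y)) = y"
  proof (rule brouwer_ball[OF r(1), of c "p \<circ> g \<circ> q"])
    have "continuous_on (cball c r) q" "q ` cball c r \<subseteq> D"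
      using q sub by (auto intro: continuous_on_subset)
    moreover have "g ` D \<subseteq> D" using K by auto
    ultimately show "continuous_on (cball c r) (p \<circ> g \<circ> q)"
      using p g by (intro continuous_on_compose) (auto intro: continuous_on_subset)
    show "p \<circ> g \<circ> q \<in> cball c r \<rightarrow> cball c r"
      using q(2) sub K(3) pK by fastforce
  qed auto
  have qy: "q y \<in> D" using y sub q(2) by blast
  then have "g (q y) = q y" using y(2) p(3) K by (metis image_subset_iff subsetD)
  with qy show ?thesis using that by blast
qed

section \<open>Multipliers of holomorphic maps into a compact part of their domain\<close>

lemma funpow_holomorphic:
  assumes h: "h holomorphic_on D" "h ` D \<subseteq> D"
  shows "(h ^^ n) holomorphic_on D \<and> (h ^^ n) ` D \<subseteq> D"
proof (induction n)
  case (Suc n)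
  then have "(h \<circ> (h ^^ n)) holomorphic_on D"
    using h by (intro holomorphic_on_compose_gen[of _ _ _ D]) auto
  with Suc h show ?case by (auto simp: image_subset_iff o_def)
qed (auto simp: id_def)

lemma funpow_has_field_derivative:
  assumes h: "(h has_field_derivative \<mu>) (at a)" "h a = a"
  shows "((h ^^ n) has_field_derivative \<mu> ^ n) (at a) \<and> (h ^^ n) a = a"
proof (induction n)
  case (Suc n)
  then have "((h \<circ> (h ^^ n)) has_field_derivative \<mu> * \<mu> ^ n) (at a)"
    using h by (intro DERIV_chain) auto
  then show ?case using Suc h by (simp add: o_def)
qed (auto intro!: derivative_eq_intros simp: id_def)

text \<open>All iterates from the first on take values in \<open>K\<close> on one fixed disc, so
  Cauchy's estimate bounds every power of the multiplier by the same \<open>M / r\<close>.\<close>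

lemma norm_multiplier_le_1:
  assumes D: "open D" "a \<in> D" and h: "h holomorphic_on D" "h a = a"
    and K: "bounded K" "K \<subseteq> D" "h ` D \<subseteq> K"
  shows "norm (deriv h a) \<le> 1"
proof (rule ccontr)
  assume "\<not> norm (deriv h a) \<le> 1"
  then have gt: "norm (deriv h a) > 1" by simp
  obtain r where r: "r > 0" "cball a r \<subseteq> D"
    using D open_contains_cball by blast
  obtain M where M: "\<And>z. z \<in> K \<Longrightarrow> norm z \<le> M"
    using K(1) by (auto simp: bounded_iff)
  have le: "norm (deriv h a) ^ Suc n \<le> M / r" for n
  proof -
    have "h ` D \<subseteq> D" using K by auto
    note hol = funpow_holomorphic[OF h(1) this, of "Suc n"] and hol' = funpow_holomorphic[OF h(1) this, of n]
    have "(h has_field_derivative deriv h a) (at a)"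
      using h(1) D by (rule holomorphic_derivI)
    from funpow_has_field_derivative[OF this h(2), of "Suc n"]
    have "deriv (h ^^ Suc n) a = deriv h a ^ Suc n"
      using DERIV_imp_deriv by blast
    moreover have "norm ((deriv ^^ 1) (h ^^ Suc n) a) \<le> fact 1 * M / r ^ 1"
    proof (rule Cauchy_inequality)
      show "(h ^^ Suc n) holomorphic_on ball a r"
        by (rule holomorphic_on_subset[of _ D]) (use hol r in auto)
      show "continuous_on (cball a r) (h ^^ Suc n)"
        by (rule continuous_on_subset[OF holomorphic_on_imp_continuous_on[OF conjunct1[OF hol]] r(2)])
      fix x assume "norm (a - x) = r"
      then have "x \<in> D" using r by (auto simp: dist_norm)
      then have "(h ^^ n) x \<in> D" using hol' by blast
      then have "(h ^^ Suc n) x \<in> K" using K by auto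
      then show "norm ((h ^^ Suc n) x) \<le> M" by (rule M)
    qed (use r in auto)
    moreover have "(deriv ^^ 1) F = deriv F" for F :: "complex \<Rightarrow> complex" by simp
    ultimately have "norm (deriv h a ^ Suc n) \<le> M / r" by (metis fact_1 mult_1 power_one_right)
    then show ?thesis by (simp only: norm_power)
  qed
  obtain n where n: "M / r < norm (deriv h a) ^ n"
    using real_arch_pow[OF gt] by blast
  also have "\<dots> \<le> norm (deriv h a) ^ Suc n"
    using gt by (intro power_increasing) auto
  finally show False using le[of n] by simp
qed

text \<open>Enlarging \<open>g\<close> about its fixed point by a factor slightly above 1 still maps \<open>D\<close> into a
  compact subset of itself, so the bound for non-strict contractions applies to a larger multiplier.\<close>

lemma norm_multiplier_less_1:
  assumes D: "open D" "a \<in> D" and g: "g holomorphic_on D" "g a = a"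
    and K: "compact K" "K \<subseteq> D" "g ` D \<subseteq> K"
  shows "norm (deriv g a) < 1"
proof -
  obtain e where e: "e > 0" "(\<Union>x\<in>K. cball x e) \<subseteq> D"
    using compact_subset_open_imp_cball_epsilon_subset[OF K(1) D(1) K(2)] by blast
  obtain B where B: "B > 0" "\<And>z. z \<in> K \<Longrightarrow> norm (z - a) \<le> B"
    using compact_imp_bounded[OF compact_translation_subtract[OF K(1), of a]]
    by (auto simp: bounded_pos)
  \<comment> \<open>Points of \<open>K\<close> are within \<open>B\<close> of \<open>a\<close>, so
    enlarging by \<open>1 + \<epsilon>\<close> moves values of \<open>g\<close> by at most
    \<open>e\<close>.\<close>
  define \<epsilon> where "\<epsilon> = e / B"
  have \<epsilon>: "\<epsilon> > 0" using e B by (simp add: \<epsilon>_def)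
  define h where "h z = g z + of_real \<epsilon> * (g z - a)" for z
  have "norm (deriv h a) \<le> 1"
  proof (rule norm_multiplier_le_1[OF D])
    show "h holomorphic_on D" unfolding h_def by (intro holomorphic_intros g)
    show "h a = a" by (simp add: h_def g)
    show "(\<Union>x\<in>K. cball x e) \<subseteq> D" by (rule e)
    show "bounded (\<Union>x\<in>K. cball x e)"
      using compact_minkowski_sum_cball[OF K(1)] compact_imp_bounded by blast
    show "h ` D \<subseteq> (\<Union>x\<in>K. cball x e)"
    proof safe
      fix z assume "z \<in> D"
      then have gz: "g z \<in> K" using K by auto
      have "dist (g z) (h z) = \<epsilon> * norm (g z - a)"
        using \<epsilon> by (simp add: dist_norm h_def norm_mult)
      also have "\<dots> \<le> \<epsilon> * B"
        using B gz \<epsilon> by (intro mult_left_mono) auto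
      also have "\<dots> = e" using B by (simp add: \<epsilon>_def)
      finally show "h z \<in> (\<Union>x\<in>K. cball x e)" using gz by auto
    qed
  qed
  moreover have "(g has_field_derivative deriv g a) (at a)"
    using g(1) D by (rule holomorphic_derivI)
  then have "(h has_field_derivative (1 + of_real \<epsilon>) * deriv g a) (at a)"
    unfolding h_def by (auto intro!: derivative_eq_intros simp: algebra_simps)
  then have "deriv h a = of_real (1 + \<epsilon>) * deriv g a"
    using DERIV_imp_deriv by fastforce
  ultimately have "(1 + \<epsilon>) * norm (deriv g a) \<le> 1"
    using \<epsilon> by (simp only: norm_mult norm_of_real)
  then have "norm (deriv g a) \<le> 1 / (1 + \<epsilon>)"
    using \<epsilon> by (simp add: field_simps)
  also have "\<dots> < 1" using \<epsilon> by simp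
  finally show ?thesis .
qed

text \<open>A finite value excludes a pole and meromorphy excludes an essential singularity, so the
  singularity is removable.\<close>

lemma sphere_map_meromorphic:
  assumes f: "f meromorphic_on UNIV" and z: "sphere_map f z = Some w"
  shows "remove_sings f analytic_on {z}" and "remove_sings f z = w"
    and "\<forall>\<^sub>F x in at z. f x = remove_sings f x"
proof -
  have np: "\<not> is_pole f z" and w: "remove_sings f z = w"
    using z by (auto simp: sphere_map_def split: if_splits)
  have iso: "isolated_singularity_at f z" and ne: "not_essential f z"
    using f by (auto simp: meromorphic_on_altdef)
  then obtain c where "f \<midarrow>z\<rightarrow> c" using np by (auto simp: not_essential_def)
  with iso show "remove_sings f analytic_on {z}" by (rule remove_sings_analytic_at)
  show "remove_sings f z = w" by (rule w)
  show "\<forall>\<^sub>F x in at z. f x = remove_sings f x"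
    using eventually_remove_sings_eq_at[OF iso] by eventually_elim simp
qed

lemma attracting_fixed_point_iff_disk:
  assumes f: "f meromorphic_on UNIV"
  shows "(\<exists>a. attracting_fixed_point (sphere_map f) a) \<longleftrightarrow>
     (\<exists>D. topological_disk D \<and> riemann_sphere closure_of (sphere_map f ` D) \<subseteq> Some ` D)"
proof
  assume "\<exists>a. attracting_fixed_point (sphere_map f) a"
  then obtain a where a: "sphere_map f a = Some a" "norm (multiplier (sphere_map f) a) < 1"
    by (auto simp: attracting_fixed_point_def fixed_point_def)
  define g where "g = remove_sings f"
  note mero = sphere_map_meromorphic[OF f a(1), folded g_def]
  note loc = sphere_map_removable[OF mero(3) mero(1)]
  have "norm (deriv g a) < 1" using loc(3) a(2) by simp
  \<comment> \<open>Any factor strictly between the multiplier and 1 gives a disc whose image lies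
    in a strictly smaller concentric closed disc.\<close>
  then obtain l where l: "norm (deriv g a) < l" "l < 1" using dense by blast
  have "(g has_field_derivative deriv g a) (at a)"
    using mero(1) analytic_on_imp_differentiable_at DERIV_deriv_iff_field_differentiable by blast
  then have "(\<lambda>z. norm ((g z - g a) / (z - a))) \<midarrow>a\<rightarrow> norm (deriv g a)"
    by (intro tendsto_norm) (simp add: has_field_derivative_iff)
  then have "\<forall>\<^sub>F z in at a. norm ((g z - g a) / (z - a)) < l"
    using l(1) by (rule order_tendstoD)
  then have "\<forall>\<^sub>F z in nhds a. norm (g z - a) \<le> l * norm (z - a)"
    unfolding eventually_at_filter
  proof eventually_elim
    case (elim z)
    then show ?case using mero(2) by (cases "z = a") (auto simp: norm_divide divide_simps split: if_splits)
  qed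
  with loc(1) have "\<forall>\<^sub>F z in nhds a. sphere_map f z = Some (g z) \<and> norm (g z - a) \<le> l * norm (z - a)"
    by eventually_elim simp
  then obtain r where r: "r > 0"
    "\<And>z. dist z a < r \<Longrightarrow> sphere_map f z = Some (g z) \<and> norm (g z - a) \<le> l * norm (z - a)"
    unfolding eventually_nhds_metric by blast
  have l0: "l > 0" using l(1) norm_ge_zero[of "deriv g a"] by linarith
  have "sphere_map f ` ball a r \<subseteq> Some ` cball a (l * r)"
  proof safe
    fix z assume "z \<in> ball a r"
    then have z: "norm (z - a) < r" "sphere_map f z = Some (g z)" "norm (g z - a) \<le> l * norm (z - a)"
      using r(2)[of z] by (auto simp: dist_norm norm_minus_commute)
    moreover have "l * norm (z - a) \<le> l * r" using z(1) l0 by simp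
    ultimately show "sphere_map f z \<in> Some ` cball a (l * r)"
      by (auto simp: dist_norm norm_minus_commute)
  qed
  \<comment> \<open>The smaller closed disc is compact, hence closed in the sphere, so it also
    contains the closure of the image.\<close>
  then have "riemann_sphere closure_of (sphere_map f ` ball a r) \<subseteq> Some ` cball a (l * r)"
    by (intro closure_of_minimal) auto
  also have "\<dots> \<subseteq> Some ` ball a r"
  proof (intro image_mono)
    have "l * r < r" using r(1) l(2) by simp
    then show "cball a (l * r) \<subseteq> ball a r" by auto
  qed
  finally have "riemann_sphere closure_of (sphere_map f ` ball a r) \<subseteq> Some ` ball a r" .
  moreover have "topological_disk (ball a r)"
    using homeomorphic_balls(1)[of r 1 a 0] r(1) by (simp add: topological_disk_def)
  ultimately show "\<exists>D. topological_disk D \<and> riemann_sphere closure_of (sphere_map f ` D) \<subseteq> Some ` D"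
    by blast
next
  assume "\<exists>D. topological_disk D \<and> riemann_sphere closure_of (sphere_map f ` D) \<subseteq> Some ` D"
  then obtain D where D: "open D" "D homeomorphic ball (0::complex) 1"
    and cl: "riemann_sphere closure_of (sphere_map f ` D) \<subseteq> Some ` D"
    by (auto simp: topological_disk_def)
  define K where "K = {z. Some z \<in> riemann_sphere closure_of (sphere_map f ` D)}"
  have CK: "riemann_sphere closure_of (sphere_map f ` D) = Some ` K"
    using cl by (auto simp: K_def)
  \<comment> \<open>A closed set of the one-point compactification that misses infinity is compact
    in the plane.\<close>
  have "closedin riemann_sphere (Some ` K)"
    unfolding CK[symmetric] by (rule closedin_closure_of)
  then have K: "compact K" by simp
  have KD: "K \<subseteq> D" using cl by (auto simp: CK)
  have "x \<in> topspace riemann_sphere" for x :: "complex option"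
    by (cases x) auto
  then have fK: "sphere_map f ` D \<subseteq> Some ` K"
    unfolding CK[symmetric] by (intro closure_of_subset) auto
  define g where "g = remove_sings f"
  \<comment> \<open>The image avoids \<open>None\<close>, so there is no pole in \<open>D\<close>
    and \<open>g\<close> is the finite-valued map.\<close>
  have sm: "sphere_map f z = Some (g z)" "g z \<in> K" if "z \<in> D" for z
    using fK that by (auto simp: g_def sphere_map_def split: if_splits)
  have "g analytic_on D"
    using sphere_map_meromorphic(1)[OF f sm(1)] unfolding g_def by (subst analytic_on_analytic_at) auto
  then have hol: "g holomorphic_on D" by (rule analytic_imp_holomorphic)
  have gK: "g ` D \<subseteq> K" using sm by auto
  obtain a where a: "a \<in> D" "g a = a"
    using homeomorphic_ball_fixed_point[OF D(2) holomorphic_on_imp_continuous_on[OF hol] K KD gK] by blast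
  have "norm (deriv g a) < 1"
    by (rule norm_multiplier_less_1[OF D(1) a(1) hol a(2) K KD gK])
  moreover have "sphere_map f a = Some a" using sm a by simp
  note mero = sphere_map_meromorphic[OF f this, folded g_def]
  have "multiplier (sphere_map f) a = deriv g a"
    by (rule sphere_map_removable(3)[OF mero(3) mero(1)])
  ultimately show "\<exists>a. attracting_fixed_point (sphere_map f) a"
    using \<open>sphere_map f a = Some a\<close> by (auto simp: attracting_fixed_point_def fixed_point_def)
qed

section \<open>The equivalences\<close>

theorem theorem1:
  shows "((riemann_hypothesis \<and> (\<forall>s. nontrivial_zeta_zero s \<longrightarrow> zorder zeta s = 1))
            \<longleftrightarrow> (\<forall>s. nontrivial_zeta_zero s \<longrightarrow> indifferent_fixed_point nu_zeta s))
       \<and> ((\<forall>s. nontrivial_zeta_zero s \<longrightarrow> indifferent_fixed_point nu_zeta s)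
            \<longleftrightarrow> \<not> (\<exists>\<alpha>. attracting_fixed_point nu_zeta \<alpha>))
       \<and> (\<not> (\<exists>\<alpha>. attracting_fixed_point nu_zeta \<alpha>)
            \<longleftrightarrow> \<not> (\<exists>D. topological_disk D \<and>
                      riemann_sphere closure_of (nu_zeta ` D) \<subseteq> Some ` D))"
proof -
  have ab: "\<forall>s. nontrivial_zeta_zero s \<longrightarrow> indifferent_fixed_point nu_zeta s"
    if "riemann_hypothesis" "\<forall>s. nontrivial_zeta_zero s \<longrightarrow> zorder zeta s = 1"
    using that by (auto simp: riemann_hypothesis_def nontrivial_zeta_zero_iff zeta_zero_indifferent_iff)
  have bc: "\<not> attracting_fixed_point nu_zeta a"
    if b: "\<forall>s. nontrivial_zeta_zero s \<longrightarrow> indifferent_fixed_point nu_zeta s" for a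
  proof
    assume att: "attracting_fixed_point nu_zeta a"
    then have a: "zeta_entire a = 0" by (rule attracting_fixed_point_imp_zero)
    show False
    proof (cases "nontrivial_zeta_zero a")
      case True
      then show False
        using b att by (auto simp: attracting_fixed_point_def indifferent_fixed_point_def)
    next
      case False
      \<comment> \<open>The remaining zeros are the trivial ones. Their negative real part makes the
        product with the order nonpositive, so they cannot be attracting.\<close>
      then have "Re a < 0" using a by (auto simp: nontrivial_zeta_zero_iff)
      then have "of_int (zorder zeta a) * Re a \<le> 0"
        using zeta_zero_indifferent_iff(3)[OF a] by (intro mult_nonneg_nonpos) auto
      then show False using att zeta_zero_indifferent_iff(2)[OF a] by linarith
    qed
  qed
  have ca: "riemann_hypothesis \<and> (\<forall>s. nontrivial_zeta_zero s \<longrightarrow> zorder zeta s = 1)"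
    if "\<And>a. \<not> attracting_fixed_point nu_zeta a"
    using no_attracting_imp_critical_simple[OF that] by (auto simp: riemann_hypothesis_def)
  have "(\<lambda>z. z - zeta_entire z * (z - 1) / (z * nu_denom z)) meromorphic_on UNIV"
    by (intro meromorphic_intros analytic_on_imp_meromorphic_on zeta_entire_analytic nu_denom_analytic)
  from attracting_fixed_point_iff_disk[OF this] show ?thesis
    unfolding nu_zeta_eq[symmetric] using ab bc ca by blast
qed

end
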